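(* Let $N = N_{\underline\mu,P} = \Gamma_{\underline\mu,P}\backslash(\mathbb{C}^{2n}\ltimes_\rho\mathbb{C}^{2m})$ be as constructed in the context, and let $\mathcal{J}$ be the almost-complex structure on $N$ with global $(1,0)$-coframe $\{\alpha^1,\dots,\alpha^{2n},\beta^1,\dots,\beta^{2m}\}$ given by $$\alpha^i = \varphi^i\ (i=1,\dots,2n),\qquad \beta^{2j+1} = \tfrac{\sqrt2}{2}\left(\psi^{2j+1}+\sqrt{-1}\,\psi^{2j+2}\right),\qquad \beta^{2j+2} = \tfrac{\sqrt2}{2}\left(\bar\psi^{2j+1}+\sqrt{-1}\,\bar\psi^{2j+2}\right)\ (j=0,\dots,m-1).$$ Then $\kappa^{\mathcal{J}}(N) = 0$.
   Context: Construction. Let $n,m\ge1$ and let $M\in\mathrm{SL}(2m,\mathbb{Z})$ be a matrix for which there exist $P\in \mathrm{GL}(2m,\mathbb{R})$ and a real number $\lambda\neq 0$ with $PMP^{-1} = \mathrm{diag}(e^{\lambda},e^{-\lambda},\dots,e^{\lambda},e^{-\lambda})$. Denote coordinates of $\mathbb{C}^{2n}$ by $w=(w_1,\dots,w_{2n})$ and of $\mathbb{C}^{2m}$ by $z=(z_1,\dots,z_{2m})$. Put $a(w) = w_1+\bar w_2+\cdots+w_{2n-1}+\bar w_{2n}$, and define $\rho:\mathbb{C}^{2n}\to \mathrm{GL}(2m,\mathbb{C})$ by $\rho(w) = \mathrm{diag}(e^{\lambda a(w)}, e^{-\lambda\overline{a(w)}},\dots,e^{\lambda a(w)},e^{-\lambda\overline{a(w)}})$.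 $\mathbb{C}^{2n}\ltimes_\rho\mathbb{C}^{2m}$ has product $(w',z')*(w,z) = (w'+w,\rho(w')z+z')$. Let $\underline\mu = \mathrm{diag}(\mu_1,\dots,\mu_{2n})$ with $\mu_i = \frac{2k_i\pi}{\lambda}$, $k_i\in\mathbb{Z}\setminus\{0\}$, and put $\Gamma'_{\underline\mu} = \mathbb{Z}^{2n}\oplus\sqrt{-1}\,\underline\mu\mathbb{Z}^{2n}$, $\Gamma''_P = P\mathbb{Z}^{2m}\oplus\sqrt{-1}\,P\mathbb{Z}^{2m}$. Then $\Gamma_{\underline\mu,P} = \Gamma'_{\underline\mu}\ltimes_\rho\Gamma''_P$ is a lattice in $\mathbb{C}^{2n}\ltimes_\rho\mathbb{C}^{2m}$. The forms $\varphi^i = dw_i$ ($i=1,\dots,2n$), $\psi^{2j+1} = e^{-\lambda a(w)}dz_{2j+1}$, $\psi^{2j+2} = e^{\lambda\overline{a(w)}}dz_{2j+2}$ ($j=0,\dots,m-1$) descend to $N$. Kodaira dimension of a compact almost-complex manifold $(X,\mathcal{J})$ of real dimension $2d$: let $P_{r,\mathcal{J}} = \dim_{\mathbb{C}} H^0(X,(\Lambda^{d,0}X)^{\otimes r})$ be the dimension of the space of smooth sections of $(\Lambda^{d,0}X)^{\otimes r}$ annihilated by $\bar\partial_r$, where $\bar\partial_1 = \bar\partial:\Lambda^{d,0}\to\Lambda^{d,1}\cong\Lambda^{0,1}\otimes\Lambda^{d,0}$ (the $(d,1)$-component of the exterior derivative) and $\bar\partial_r$ is its extension to tensor powers by the Leibniz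 rule. Then $\kappa^{\mathcal{J}}(X) = -\infty$ if $P_{r,\mathcal{J}}=0$ for all $r\ge1$, and $\kappa^{\mathcal{J}}(X) = \limsup_{r\to+\infty}\frac{\log P_{r,\mathcal{J}}}{\log r}$ otherwise. *)

theory Defs
  imports "HOL-Analysis.Analysis" "HOL-Library.Function_Algebras"
begin

section \<open>Smooth maps on open subsets of Euclidean spaces\<close>

text \<open>Only meant for open \<open>S\<close>: \<open>f\<close> is \<open>C\<^sup>k\<^sup>+\<^sup>1\<close> iff it is differentiable with \<open>C\<^sup>k\<close> directional
  derivatives.\<close>

primrec Ck_on :: "nat \<Rightarrow> 'a::euclidean_space set \<Rightarrow> ('a \<Rightarrow> 'b::real_normed_vector) \<Rightarrow> bool" where
  "Ck_on 0 S f \<longleftrightarrow> continuous_on S f"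
| "Ck_on (Suc k) S f \<longleftrightarrow>
     f differentiable_on S \<and> (\<forall>v. Ck_on k S (\<lambda>x. frechet_derivative f (at x) v))"

definition smooth_on :: "'a::euclidean_space set \<Rightarrow> ('a \<Rightarrow> 'b::real_normed_vector) \<Rightarrow> bool" where
  "smooth_on S f \<longleftrightarrow> (\<forall>k. Ck_on k S f)"


section \<open>Complex-valued alternating forms and their bidegree\<close>

text \<open>A \<open>k\<close>-form on a real vector space \<open>'v\<close> takes a sequence of vectors and only looks at the
  entries \<open>0,\<dots>,k-1\<close>.\<close>

type_synonym 'v form = "(nat \<Rightarrow> 'v) \<Rightarrow> complex"

definition alternating_form :: "nat \<Rightarrow> 'v::real_vector form \<Rightarrow> bool" where
  "alternating_form k \<omega> \<longleftrightarrow>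
     (\<forall>v v'. (\<forall>i<k. v i = v' i) \<longrightarrow> \<omega> v = \<omega> v') \<and>
     (\<forall>v. \<forall>i<k. linear (\<lambda>u. \<omega> (v(i := u)))) \<and>
     (\<forall>v i j. i < k \<and> j < k \<and> i \<noteq> j \<and> v i = v j \<longrightarrow> \<omega> v = 0)"

text \<open>Complex-multilinear extension of a real-multilinear form to the complexification of \<open>'v\<close>,
  the pair \<open>(a, b)\<close> standing for \<open>a + \<i> b\<close>.\<close>

definition cext :: "nat \<Rightarrow> 'v form \<Rightarrow> (nat \<Rightarrow> 'v \<times> 'v) \<Rightarrow> complex" where
  "cext k \<omega> z = (\<Sum>T\<in>Pow {..<k}. \<i> ^ card T * \<omega> (\<lambda>i. if i \<in> T then snd (z i) else fst (z i)))"

text \<open>The \<open>(1,0)\<close>-part \<open>(v - \<i> J v) / 2\<close> and the \<open>(0,1)\<close>-part \<open>(v + \<i> J v) / 2\<close> of a real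
  vector, for a linear complex structure \<open>J\<close>.\<close>

definition vec10 :: "('v::real_vector \<Rightarrow> 'v) \<Rightarrow> 'v \<Rightarrow> 'v \<times> 'v" where
  "vec10 J v = ((1/2) *\<^sub>R v, - (1/2) *\<^sub>R J v)"

definition vec01 :: "('v::real_vector \<Rightarrow> 'v) \<Rightarrow> 'v \<Rightarrow> 'v \<times> 'v" where
  "vec01 J v = ((1/2) *\<^sub>R v, (1/2) *\<^sub>R J v)"

text \<open>Projection of a \<open>(p+q)\<close>-form to its \<open>(p,q)\<close>-component: split every argument into its
  \<open>(1,0)\<close>- and \<open>(0,1)\<close>-part, expand, and keep the summands with exactly \<open>p\<close> arguments of
  type \<open>(1,0)\<close>.\<close>

definition type_component ::
  "nat \<Rightarrow> nat \<Rightarrow> ('v::real_vector \<Rightarrow> 'v) \<Rightarrow> 'v form \<Rightarrow> 'v form" where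
  "type_component p q J \<omega> v =
     (\<Sum>S\<in>{S. S \<subseteq> {..<p+q} \<and> card S = p}.
        cext (p+q) \<omega> (\<lambda>i. if i \<in> S then vec10 J (v i) else vec01 J (v i)))"

definition forms_of_type ::
  "nat \<Rightarrow> nat \<Rightarrow> ('v::real_vector \<Rightarrow> 'v) \<Rightarrow> 'v form set" where
  "forms_of_type p q J = {\<omega>. alternating_form (p+q) \<omega> \<and> type_component p q J \<omega> = \<omega>}"


section \<open>The operator dbar on the canonical bundle and its tensor powers, in coordinates\<close>

text \<open>Throughout, \<open>J x\<close> is the complex structure at the point \<open>x\<close>, and \<open>DIM('v)\<close> is twice the
  complex dimension \<open>cdim\<close>.\<close>

definition cdim :: "'v::euclidean_space itself \<Rightarrow> nat" where
  "cdim _ = DIM('v) div 2"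

definition canonical_fibre :: "('v::euclidean_space \<Rightarrow> 'v) \<Rightarrow> 'v form set" where
  "canonical_fibre Jx = forms_of_type (cdim TYPE('v)) 0 Jx"

definition ext_deriv ::
  "nat \<Rightarrow> ('v::euclidean_space \<Rightarrow> 'v form) \<Rightarrow> 'v \<Rightarrow> 'v form" where
  "ext_deriv k \<omega> x v =
     (\<Sum>i\<le>k. (-1) ^ i *
        frechet_derivative (\<lambda>y. \<omega> y (\<lambda>j. if j < i then v j else v (Suc j))) (at x) (v i))"

text \<open>The \<open>(d,1)\<close>-component of the exterior derivative of a \<open>(d,0)\<close>-form, seen in the tensor
  product of the \<open>(0,1)\<close>- and the \<open>(d,0)\<close>-covectors.  The isomorphism sends \<open>\<theta> \<and> \<Omega>\<close> to
  \<open>\<theta> \<otimes> \<Omega>\<close>, i.e. it evaluates the first argument on its \<open>(0,1)\<close>-part and the others on their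
  \<open>(1,0)\<close>-parts.\<close>

definition dbar ::
  "('v \<Rightarrow> 'v \<Rightarrow> 'v) \<Rightarrow> ('v::euclidean_space \<Rightarrow> 'v form) \<Rightarrow> 'v \<Rightarrow> 'v \<Rightarrow> 'v form" where
  "dbar J \<eta> x u v =
     (let d = cdim TYPE('v)
      in cext (Suc d) (type_component d 1 (J x) (ext_deriv d \<eta> x))
           (case_nat (vec01 (J x) u) (\<lambda>j. vec10 (J x) (v j))))"

text \<open>An element of the \<open>r\<close>-th tensor power of a space of forms is a function of \<open>r\<close> blocks
  \<open>v 0,\<dots>,v (r-1)\<close> of arguments, the tensor product of \<open>\<omega> 0,\<dots>,\<omega> (r-1)\<close> being the product of the
  \<open>\<omega> i (v i)\<close>.\<close>

type_synonym 'v tensor = "(nat \<Rightarrow> nat \<Rightarrow> 'v) \<Rightarrow> complex"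

definition pure_tensor :: "nat \<Rightarrow> (nat \<Rightarrow> 'v form) \<Rightarrow> 'v tensor" where
  "pure_tensor r \<omega> v = (\<Prod>i<r. \<omega> i (v i))"

definition tensor_power :: "nat \<Rightarrow> 'v form set \<Rightarrow> 'v tensor set" where
  "tensor_power r L =
     {T. \<exists>(N::nat) \<omega>. (\<forall>k<N. \<forall>i<r. \<omega> k i \<in> L) \<and> T = (\<lambda>v. \<Sum>k<N. pure_tensor r (\<omega> k) v)}"

definition smooth_canonical_form ::
  "('v \<Rightarrow> 'v \<Rightarrow> 'v) \<Rightarrow> 'v set \<Rightarrow> ('v::euclidean_space \<Rightarrow> 'v form) \<Rightarrow> bool" where
  "smooth_canonical_form J U \<eta> \<longleftrightarrow>
     (\<forall>y\<in>U. \<eta> y \<in> canonical_fibre (J y)) \<and> (\<forall>v. smooth_on U (\<lambda>y. \<eta> y v))"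

text \<open>Extension of \<open>dbar\<close> to the \<open>r\<close>-th tensor power by the Leibniz rule: write \<open>s\<close> near \<open>x\<close> as a
  sum of tensor products of smooth sections of the canonical bundle and differentiate one factor
  at a time.  The argument \<open>u\<close> belongs to the \<open>(0,1)\<close>-covector, which is moved to the front.  The
  result does not depend on how \<open>s\<close> is written.\<close>

definition dbar_power ::
  "nat \<Rightarrow> ('v \<Rightarrow> 'v \<Rightarrow> 'v) \<Rightarrow> ('v::euclidean_space \<Rightarrow> 'v tensor) \<Rightarrow> 'v \<Rightarrow> 'v \<Rightarrow> 'v tensor" where
  "dbar_power r J s x =
     (THE t. \<exists>U (N::nat) \<eta>. open U \<and> x \<in> U \<and>
        (\<forall>k<N. \<forall>i<r. smooth_canonical_form J U (\<eta> k i)) \<and>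
        (\<forall>y\<in>U. s y = (\<lambda>v. \<Sum>k<N. pure_tensor r (\<lambda>i. \<eta> k i y) v)) \<and>
        t = (\<lambda>u v. \<Sum>k<N. \<Sum>i<r.
               dbar J (\<eta> k i) x u (v i) * (\<Prod>j\<in>{..<r} - {i}. \<eta> k j x (v j))))"


section \<open>Almost-complex manifolds and Kodaira dimension\<close>

text \<open>Smooth structures are given by an atlas of local parametrisations: the chart \<open>(U, \<psi>)\<close>
  consists of an open set \<open>U\<close> of the model space and an injective map \<open>\<psi>\<close> from \<open>U\<close> to the set of
  points.  Tensor fields are given by their local expressions in all charts of the atlas, which
  have to be related by the transition maps.\<close>

type_synonym ('v, 'p) chart = "'v set \<times> ('v \<Rightarrow> 'p)"

definition overlap :: "('v, 'p) chart \<Rightarrow> ('v, 'p) chart \<Rightarrow> 'v set" where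
  "overlap c c' = {x \<in> fst c. snd c x \<in> snd c' ` fst c'}"

definition transition :: "('v, 'p) chart \<Rightarrow> ('v, 'p) chart \<Rightarrow> 'v \<Rightarrow> 'v" where
  "transition c c' x = inv_into (fst c') (snd c') (snd c x)"

definition almost_complex_structure ::
  "('v::euclidean_space, 'p) chart set \<Rightarrow> (('v, 'p) chart \<Rightarrow> 'v \<Rightarrow> 'v \<Rightarrow> 'v) \<Rightarrow> bool" where
  "almost_complex_structure A J \<longleftrightarrow>
     (\<forall>c\<in>A. (\<forall>x\<in>fst c. linear (J c x) \<and> (\<forall>v. J c x (J c x v) = - v)) \<and>
             (\<forall>v. smooth_on (fst c) (\<lambda>x. J c x v))) \<and>
     (\<forall>c\<in>A. \<forall>c'\<in>A. \<forall>x\<in>overlap c c'. \<forall>v.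
        frechet_derivative (transition c c') (at x) (J c x v) =
        J c' (transition c c' x) (frechet_derivative (transition c c') (at x) v))"

text \<open>Local expressions are set to \<open>0\<close> outside their domains, so that a section determines and
  is determined by its family of local expressions.\<close>

definition pluricanonical_sections ::
  "('v::euclidean_space, 'p) chart set \<Rightarrow> (('v, 'p) chart \<Rightarrow> 'v \<Rightarrow> 'v \<Rightarrow> 'v) \<Rightarrow> nat \<Rightarrow>
   (('v, 'p) chart \<Rightarrow> 'v \<Rightarrow> 'v tensor) set" where
  "pluricanonical_sections A J r =
     {s. (\<forall>c\<in>A. (\<forall>x\<in>fst c. s c x \<in> tensor_power r (canonical_fibre (J c x))) \<and>
                (\<forall>v. smooth_on (fst c) (\<lambda>x. s c x v))) \<and>
         (\<forall>c\<in>A. \<forall>c'\<in>A. \<forall>x\<in>overlap c c'. \<forall>v.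
            s c x v = s c' (transition c c' x)
                        (\<lambda>i j. frechet_derivative (transition c c') (at x) (v i j))) \<and>
         (\<forall>c x. c \<notin> A \<or> x \<notin> fst c \<longrightarrow> s c x = (\<lambda>v. 0))}"

definition holomorphic_pluricanonical_sections ::
  "('v::euclidean_space, 'p) chart set \<Rightarrow> (('v, 'p) chart \<Rightarrow> 'v \<Rightarrow> 'v \<Rightarrow> 'v) \<Rightarrow> nat \<Rightarrow>
   (('v, 'p) chart \<Rightarrow> 'v \<Rightarrow> 'v tensor) set" where
  "holomorphic_pluricanonical_sections A J r =
     {s \<in> pluricanonical_sections A J r.
        \<forall>c\<in>A. \<forall>x\<in>fst c. dbar_power r (J c) (s c) x = (\<lambda>u v. 0)}"

definition scale_section ::
  "complex \<Rightarrow> ('c \<Rightarrow> 'v \<Rightarrow> 'v tensor) \<Rightarrow> ('c \<Rightarrow> 'v \<Rightarrow> 'v tensor)" where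
  "scale_section a s = (\<lambda>c x v. a * s c x v)"

text \<open>The library's \<open>dim\<close> is \<open>0\<close> on infinite-dimensional spaces.\<close>

definition plurigenus ::
  "('v::euclidean_space, 'p) chart set \<Rightarrow> (('v, 'p) chart \<Rightarrow> 'v \<Rightarrow> 'v \<Rightarrow> 'v) \<Rightarrow> nat \<Rightarrow> enat" where
  "plurigenus A J r =
     (let H = holomorphic_pluricanonical_sections A J r
      in if \<exists>B. finite B \<and> H \<subseteq> module.span scale_section B
         then enat (vector_space.dim scale_section H) else \<infinity>)"

definition log_enat :: "enat \<Rightarrow> ereal" where
  "log_enat p = (case p of enat k \<Rightarrow> (if k = 0 then -\<infinity> else ereal (ln (real k))) | \<infinity> \<Rightarrow> \<infinity>)"

definition kodaira_dimension ::
  "('v::euclidean_space, 'p) chart set \<Rightarrow> (('v, 'p) chart \<Rightarrow> 'v \<Rightarrow> 'v \<Rightarrow> 'v) \<Rightarrow> ereal" where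
  "kodaira_dimension A J =
     (if \<forall>r\<ge>1. plurigenus A J r = 0 then -\<infinity>
      else limsup (\<lambda>r. log_enat (plurigenus A J r) / ereal (ln (real r))))"

text \<open>A family of complex-valued 1-forms, given by local expressions in the charts, that is at
  every point a basis of the \<open>(1,0)\<close>-covectors.\<close>

definition coframe10 ::
  "('v::euclidean_space, 'p) chart set \<Rightarrow> (('v, 'p) chart \<Rightarrow> 'v \<Rightarrow> 'v \<Rightarrow> 'v) \<Rightarrow>
   (('v, 'p) chart \<Rightarrow> 'k::finite \<Rightarrow> 'v \<Rightarrow> 'v \<Rightarrow> complex) \<Rightarrow> bool" where
  "coframe10 A J \<theta> \<longleftrightarrow>
     (\<forall>c\<in>A. \<forall>x\<in>fst c.
        (\<forall>k. (\<lambda>v. \<theta> c k x (v 0)) \<in> forms_of_type 1 0 (J c x)) \<and>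
        (\<forall>\<omega>\<in>forms_of_type 1 0 (J c x).
           \<exists>!a. \<omega> = (\<lambda>v. \<Sum>k\<in>UNIV. a k * \<theta> c k x (v 0))))"


section \<open>The solvmanifold\<close>

text \<open>The coordinates of \<open>\<complex>\<^sup>2\<^sup>n\<close> are indexed by \<open>'n \<times> bool\<close> with \<open>n = CARD('n)\<close>: the pair of
  neighbours \<open>w\<^bsub>2i+1\<^esub>, w\<^bsub>2i+2\<^esub>\<close> is \<open>w $ (i, False), w $ (i, True)\<close>.  Likewise for \<open>\<complex>\<^sup>2\<^sup>m\<close> and
  for matrices of size \<open>2m\<close>.\<close>

type_synonym ('n, 'm) total_space = "(complex ^ ('n \<times> bool)) \<times> (complex ^ ('m \<times> bool))"

definition diag_matrix :: "('i \<Rightarrow> 'a::zero) \<Rightarrow> 'a ^ 'i::finite ^ 'i" where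
  "diag_matrix f = (\<chi> i j. if i = j then f i else 0)"

definition real_matrix :: "int ^ 'j::finite ^ 'i::finite \<Rightarrow> real ^ 'j ^ 'i" where
  "real_matrix M = (\<chi> i j. real_of_int (M $ i $ j))"

definition a_form :: "complex ^ ('n::finite \<times> bool) \<Rightarrow> complex" where
  "a_form w = (\<Sum>i\<in>UNIV. w $ (i, False) + cnj (w $ (i, True)))"

definition rho ::
  "real \<Rightarrow> complex ^ ('n::finite \<times> bool) \<Rightarrow> complex ^ ('m::finite \<times> bool) ^ ('m \<times> bool)" where
  "rho lam w = diag_matrix (\<lambda>(j, b).
     if b then exp (- of_real lam * cnj (a_form w)) else exp (of_real lam * a_form w))"

definition semidirect_mult ::
  "real \<Rightarrow> ('n::finite, 'm::finite) total_space \<Rightarrow> ('n, 'm) total_space \<Rightarrow>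
   ('n, 'm) total_space" where
  "semidirect_mult lam = (\<lambda>(w', z') (w, z). (w' + w, rho lam w' *v z + z'))"

definition lattice_base ::
  "real \<Rightarrow> ('n::finite \<times> bool \<Rightarrow> int) \<Rightarrow> (complex ^ ('n \<times> bool)) set" where
  "lattice_base lam k =
     {w. \<exists>p q :: 'n \<times> bool \<Rightarrow> int. \<forall>i.
        w $ i = of_int (p i) + \<i> * of_real (2 * of_int (k i) * pi / lam) * of_int (q i)}"

definition lattice_fibre ::
  "real ^ ('m::finite \<times> bool) ^ ('m \<times> bool) \<Rightarrow> (complex ^ ('m \<times> bool)) set" where
  "lattice_fibre P =
     {z. \<exists>p q :: 'm \<times> bool \<Rightarrow> int. \<forall>i.
        z $ i = of_real ((P *v (\<chi> j. of_int (p j))) $ i)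
              + \<i> * of_real ((P *v (\<chi> j. of_int (q j))) $ i)}"

definition lattice ::
  "real \<Rightarrow> ('n::finite \<times> bool \<Rightarrow> int) \<Rightarrow> real ^ ('m::finite \<times> bool) ^ ('m \<times> bool) \<Rightarrow>
   ('n, 'm) total_space set" where
  "lattice lam k P = lattice_base lam k \<times> lattice_fibre P"

text \<open>The points of the quotient are the cosets \<open>\<Gamma> * g\<close>; its charts are the restrictions of the
  quotient map to the open sets on which it is injective.\<close>

definition coset ::
  "real \<Rightarrow> ('n::finite \<times> bool \<Rightarrow> int) \<Rightarrow> real ^ ('m::finite \<times> bool) ^ ('m \<times> bool) \<Rightarrow>
   ('n, 'm) total_space \<Rightarrow> ('n, 'm) total_space set" where
  "coset lam k P g = (\<lambda>\<gamma>. semidirect_mult lam \<gamma> g) ` lattice lam k P"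

definition solvmanifold ::
  "real \<Rightarrow> ('n::finite \<times> bool \<Rightarrow> int) \<Rightarrow> real ^ ('m::finite \<times> bool) ^ ('m \<times> bool) \<Rightarrow>
   (('n, 'm) total_space, ('n, 'm) total_space set) chart set" where
  "solvmanifold lam k P = {(U, coset lam k P) |U. open U \<and> inj_on (coset lam k P) U}"

text \<open>Left-invariant forms as functions of a point and a tangent vector \<open>(u, v)\<close>, where
  \<open>dw\<^sub>i\<close> is \<open>u $ i\<close> and \<open>dz\<^sub>j\<close> is \<open>v $ j\<close>.\<close>

definition phi ::
  "'n \<times> bool \<Rightarrow> ('n::finite, 'm::finite) total_space \<Rightarrow> ('n, 'm) total_space \<Rightarrow> complex" where
  "phi i = (\<lambda>(w, z) (u, v). u $ i)"

definition psi ::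
  "real \<Rightarrow> 'm \<times> bool \<Rightarrow> ('n::finite, 'm::finite) total_space \<Rightarrow> ('n, 'm) total_space \<Rightarrow>
   complex" where
  "psi lam = (\<lambda>(j, b) (w, z) (u, v).
     if b then exp (of_real lam * cnj (a_form w)) * v $ (j, True)
     else exp (- of_real lam * a_form w) * v $ (j, False))"

definition alpha_beta ::
  "real \<Rightarrow> ('n \<times> bool) + ('m \<times> bool) \<Rightarrow> ('n::finite, 'm::finite) total_space \<Rightarrow>
   ('n, 'm) total_space \<Rightarrow> complex" where
  "alpha_beta lam l x v =
     (case l of
        Inl i \<Rightarrow> phi i x v
      | Inr (j, b) \<Rightarrow>
          of_real (sqrt 2 / 2) *
          (if b then cnj (psi lam (j, False) x v) + \<i> * cnj (psi lam (j, True) x v)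
           else psi lam (j, False) x v + \<i> * psi lam (j, True) x v))"

end

theory Submission
  imports Defs "HOL-Complex_Analysis.Complex_Analysis" "Jordan_Normal_Form.Determinant"
begin

text \<open>Writing \<open>x*\<close> for complex conjugates, the structure equations are
  \<open>d \<beta>\<^bsup>2j+1\<^esup> = \<lambda>/2 (da* - da) \<and> \<beta>\<^bsup>2j+1\<^esup> - \<lambda>/2 (da + da*) \<and> (\<beta>\<^bsup>2j+2\<^esup>)*\<close> and
  \<open>d \<beta>\<^bsup>2j+2\<^esup> = \<lambda>/2 (da - da*) \<and> \<beta>\<^bsup>2j+2\<^esup> - \<lambda>/2 (da + da*) \<and> (\<beta>\<^bsup>2j+1\<^esup>)*\<close>.
  In the \<open>(d,1)\<close>-part of the differential of the left-invariant volume form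
  \<open>\<Phi> = \<alpha>\<^sup>1 \<and> \<dots> \<and> \<alpha>\<^bsup>2n\<^esup> \<and> \<beta>\<^sup>1 \<and> \<dots> \<and> \<beta>\<^bsup>2m\<^esup>\<close> the first terms cancel, and the second ones vanish since
  the \<open>(1,0)\<close>-part of \<open>da + da*\<close> is a combination of the \<open>\<alpha>\<^sup>i\<close>.  Hence \<open>\<Phi>\<^sup>r\<close> is holomorphic, and
  every holomorphic section of the \<open>r\<close>-th power is \<open>F \<Phi>\<^sup>r\<close> with \<open>F\<close> a function on the compact
  quotient that is annihilated by the Cauchy-Riemann operator.  Lifted to \<open>\<complex>\<^sup>2\<^sup>n \<times> \<complex>\<^sup>2\<^sup>m\<close>, \<open>F\<close> is
  bounded and holomorphic in \<open>w\<close>, so independent of \<open>w\<close> by Liouville.  On the fibres the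
  almost-complex structure depends on \<open>w\<close> through \<open>e\<^bsup>2\<lambda> Re a(w)\<^esup>\<close>, and a differential that is
  complex linear for two different values of it is zero.  So \<open>F\<close> is constant and all plurigenera
  are \<open>1\<close>.\<close>

hide_const (open) Determinant.det Determinant.cofactor Matrix.mat Matrix.vec
no_notation Matrix.vec_index (infixl "$" 100)
no_notation fps_nth (infixl "$" 75)

section \<open>Determinants of one-forms\<close>

text \<open>The wedge product of the covectors, without a factorial factor. Matrices whose size is a
  natural number let the degree grow from \<open>n\<close> to \<open>Suc n\<close> under the
  exterior derivative.\<close>

definition det_form ::
  "nat \<Rightarrow> (nat \<Rightarrow> 'v \<Rightarrow> complex) \<Rightarrow> 'v form" where
  "det_form n \<xi> v = Determinant.det (Matrix.mat n n (\<lambda>(i, k). \<xi> k (v i)))"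

lemma permutes_less:
  "p permutes {0..<n} \<Longrightarrow> i < n \<Longrightarrow> p i < (n::nat)"
  by (metis atLeastLessThan_iff permutes_in_image zero_le)

lemma det_form_expand:
  "det_form n \<xi> v = (\<Sum>p | p permutes {0..<n}. of_int (sign p) * (\<Prod>i<n. \<xi> (p i) (v i)))"
  unfolding det_form_def
  by (subst det_def'[of _ n])
    (auto intro!: sum.cong prod.cong simp: permutes_less atLeast0LessThan)

lemma det_form_expand_columns:
  "det_form n \<xi> v = (\<Sum>p | p permutes {0..<n}. of_int (sign p) * (\<Prod>k<n. \<xi> k (v (p k))))"
  unfolding det_form_def
  by (subst det_col[of _ n])
    (auto intro!: sum.cong prod.cong simp: permutes_less atLeast0LessThan)

lemma det_form_cong:
  assumes "\<And>i k. i < n \<Longrightarrow> k < n \<Longrightarrow> \<xi> k (v i) = \<xi>' k (v' i)"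
  shows "det_form n \<xi> v = det_form n \<xi>' v'"
  unfolding det_form_def
  by (rule arg_cong[of _ _ Determinant.det]) (auto intro!: eq_matI simp: assms)

text \<open>Laplace expansion along column 0. The minors are written with the same omitted-argument
  sequences as in \<open>ext_deriv\<close>, so that exterior derivatives of determinants can be read
  as determinants again.\<close>

lemma det_form_Suc:
  "det_form (Suc n) \<xi> v =
     (\<Sum>i\<le>n. (-1) ^ i * (\<xi> 0 (v i) *
        det_form n (\<lambda>k. \<xi> (Suc k)) (\<lambda>j. if j < i then v j else v (Suc j))))"
proof -
  let ?A = "Matrix.mat (Suc n) (Suc n) (\<lambda>(i, k). \<xi> k (v i))"
  have "mat_delete ?A i 0 =
      Matrix.mat n n (\<lambda>(j, k). \<xi> (Suc k) (if j < i then v j else v (Suc j)))" for i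
    by (auto intro!: eq_matI simp: mat_delete_def)
  then show ?thesis
    unfolding det_form_def
    by (subst laplace_expansion_column[of _ "Suc n" 0])
      (auto simp: Determinant.cofactor_def lessThan_Suc_atMost intro!: sum.cong)
qed

lemma det_form_repeated:
  assumes "i < n" "j < n" "i \<noteq> j" "v i = v j"
  shows "det_form n \<xi> v = 0"
  unfolding det_form_def
  by (rule det_identical_rows[of _ n i j]) (use assms in \<open>auto simp: Matrix.row_def\<close>)

lemma det_form_column_add:
  assumes "k < n"
  shows "det_form n (\<xi>(k := (\<lambda>v. a * f v + b * g v))) v =
    a * det_form n (\<xi>(k := f)) v + b * det_form n (\<xi>(k := g)) v"
proof -
  have *: "(\<Prod>j<n. (\<xi>(k := h)) j (v (p j))) = h (v (p k)) * (\<Prod>j\<in>{..<n}-{k}. \<xi> j (v (p j)))"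
    for h p
    using assms by (subst prod.remove[of _ k]) (auto intro!: prod.cong)
  show ?thesis
    unfolding det_form_expand_columns *
    by (simp add: sum_distrib_left sum.distrib[symmetric] algebra_simps)
qed

text \<open>The coefficients \<open>c\<close> of a linear relation between the columns form a
  nonzero kernel vector. This is the tool that kills the torsion terms in
  \<open>torsion_type\<close>.\<close>

lemma det_form_singular:
  assumes c: "k < n" "c k \<noteq> 0" and 0: "\<And>i. i < n \<Longrightarrow> (\<Sum>k<n. c k * \<xi> k (v i)) = 0"
  shows "det_form n \<xi> v = 0"
proof -
  let ?c = "Matrix.vec n c"
  have "?c \<noteq> 0\<^sub>v n"
    using c by (metis index_vec index_zero_vec(1))
  moreover have "Matrix.mat n n (\<lambda>(i, k). \<xi> k (v i)) *\<^sub>v ?c = 0\<^sub>v n"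
    using 0 by (intro eq_vecI) (auto simp: scalar_prod_def atLeast0LessThan mult.commute)
  ultimately show ?thesis
    unfolding det_form_def
    by (subst det_0_iff_vec_prod_zero_field[of _ n]) (auto intro!: exI[of _ ?c])
qed

lemma linear_det_form_slot:
  assumes "\<And>k. k < n \<Longrightarrow> linear (\<xi> k)" "i < n"
  shows "linear (\<lambda>u. det_form n \<xi> (v(i := u)))"
proof -
  have *: "(\<Prod>j<n. \<xi> (p j) ((v(i := u)) j)) = \<xi> (p i) u * (\<Prod>j\<in>{..<n}-{i}. \<xi> (p j) (v j))"
    for u p
    using assms(2) by (subst prod.remove[of _ i]) (auto intro!: prod.cong)
  have lin: "linear (\<xi> (p i))" if "p permutes {0..<n}" for p
    using that assms permutes_less by blast
  show ?thesis
    unfolding det_form_expand *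
    by (rule linearI)
      (auto simp: sum_distrib_left sum.distrib[symmetric] scaleR_sum_right
        linear_add[OF lin] linear_scale[OF lin] algebra_simps scaleR_conv_of_real intro!: sum.cong)
qed

lemma alternating_det_form:
  assumes "\<And>k. k < n \<Longrightarrow> linear (\<xi> k)"
  shows "alternating_form n (det_form n \<xi>)"
  unfolding alternating_form_def
proof (intro conjI allI impI)
  show "det_form n \<xi> v = det_form n \<xi> v'" if "\<forall>i<n. v i = v' i" for v v'
    using that by (auto intro: det_form_cong)
  show "linear (\<lambda>u. det_form n \<xi> (v(i := u)))" if "i < n" for v i
    using assms that by (rule linear_det_form_slot)
  show "det_form n \<xi> v = 0" if "i < n \<and> j < n \<and> i \<noteq> j \<and> v i = v j" for v i j
    using that det_form_repeated by blast
qed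

section \<open>Complexification and bidegree\<close>

text \<open>What \<open>cext\<close> amounts to for a single covector: its complex-linear
  extension.\<close>

definition clin ::
  "('v \<Rightarrow> complex) \<Rightarrow> 'v \<times> 'v \<Rightarrow> complex" where
  "clin \<xi> z = \<xi> (fst z) + \<i> * \<xi> (snd z)"

text \<open>Multiplying out the binomials that \<open>clin\<close> contributes gives one summand for
  each subset of the arguments, which is the sum defining \<open>cext\<close>.\<close>

lemma cext_prod:
  "cext n (\<lambda>v. \<Prod>i<n. \<xi> i (v i)) z = (\<Prod>i<n. clin (\<xi> i) (z i))"
proof -
  have *: "(\<Prod>i\<in>T. \<i> * \<xi> i (snd (z i))) * (\<Prod>i\<in>{..<n} - T. \<xi> i (fst (z i))) =
      \<i> ^ card T * (\<Prod>i<n. \<xi> i (if i \<in> T then snd (z i) else fst (z i)))" if "T \<subseteq> {..<n}" for T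
  proof -
    have "(\<Prod>i<n. \<xi> i (if i \<in> T then snd (z i) else fst (z i))) =
        (\<Prod>i\<in>T. \<xi> i (snd (z i))) * (\<Prod>i\<in>{..<n} - T. \<xi> i (fst (z i)))"
      using that by (subst prod.subset_diff[of T]) (auto intro!: prod.cong simp: mult.commute)
    then show ?thesis
      by (simp add: prod.distrib)
  qed
  have "(\<Prod>i<n. clin (\<xi> i) (z i)) = (\<Prod>i<n. \<i> * \<xi> i (snd (z i)) + \<xi> i (fst (z i)))"
    by (simp add: clin_def add.commute)
  also have "\<dots> = cext n (\<lambda>v. \<Prod>i<n. \<xi> i (v i)) z"
    unfolding cext_def by (subst prod_add) (auto intro!: sum.cong simp: *)
  finally show ?thesis ..
qed

lemma cext_sum:
  "cext n (\<lambda>v. \<Sum>a\<in>A. c a * \<omega> a v) z = (\<Sum>a\<in>A. c a * cext n (\<omega> a) z)"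
  unfolding cext_def sum_distrib_left
  by (subst sum.swap) (auto intro!: sum.cong simp: mult_ac)

lemma cext_det_form:
  "cext n (det_form n \<xi>) z = det_form n (\<lambda>k. clin (\<xi> k)) z"
  unfolding det_form_expand[abs_def] cext_sum
  by (intro sum.cong refl arg_cong2[of _ _ _ _ "(*)"] cext_prod)

lemma type_component_sum:
  "type_component p q J (\<lambda>v. \<Sum>a\<in>A. c a * \<omega> a v) =
    (\<lambda>v. \<Sum>a\<in>A. c a * type_component p q J (\<omega> a) v)"
  unfolding type_component_def cext_sum sum_distrib_left
  by (rule ext, subst sum.swap) simp

text \<open>The projections to types (1,0) and (0,1) are idempotent and annihilate each other, so a
  part of a covector only sees vectors of its own type.\<close>

lemma clin_part:
  fixes J :: "'v::real_vector \<Rightarrow> 'v" and \<xi> :: "'v \<Rightarrow> complex"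
  assumes "linear \<xi>" "linear J" "\<And>v. J (J v) = - v"
  shows "clin (\<lambda>v. clin \<xi> (if s then vec10 J v else vec01 J v)) (if t then vec10 J u else vec01 J u)
    = (if s = t then clin \<xi> (if t then vec10 J u else vec01 J u) else 0)"
  using assms
  by (auto simp: clin_def vec10_def vec01_def linear_scale linear_neg linear_add linear_diff
      scaleR_conv_of_real algebra_simps)

lemma cext_type_component_prod:
  fixes J :: "'v::real_vector \<Rightarrow> 'v"
  assumes \<xi>: "\<And>i. i < p + q \<Longrightarrow> linear (\<xi> i)" and J: "linear J" "\<And>v. J (J v) = - v"
    and S0: "S0 \<subseteq> {..<p+q}" "card S0 = p"
    and z: "\<And>i. i < p + q \<Longrightarrow> z i = (if i \<in> S0 then vec10 J (v i) else vec01 J (v i))"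
  shows "cext (p+q) (type_component p q J (\<lambda>v. \<Prod>i<p+q. \<xi> i (v i))) z =
    cext (p+q) (\<lambda>v. \<Prod>i<p+q. \<xi> i (v i)) z"
proof -
  define part where "part S i u = clin (\<xi> i) (if i \<in> S then vec10 J u else vec01 J u)" for S i u
  let ?\<S> = "{S. S \<subseteq> {..<p+q} \<and> card S = p}"
  have fin: "finite ?\<S>"
    by (rule finite_subset[of _ "Pow {..<p+q}"]) auto
  have "type_component p q J (\<lambda>v. \<Prod>i<p+q. \<xi> i (v i)) =
      (\<lambda>v. \<Sum>S\<in>?\<S>. 1 * (\<Prod>i<p+q. part S i (v i)))"
    unfolding type_component_def cext_prod part_def by simp
  then have "cext (p+q) (type_component p q J (\<lambda>v. \<Prod>i<p+q. \<xi> i (v i))) z =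
      (\<Sum>S\<in>?\<S>. \<Prod>i<p+q. clin (part S i) (z i))"
    by (simp only: cext_sum) (simp only: mult_1 cext_prod[of "p + q" "part S" z for S])
  also have "\<dots> = (\<Sum>S\<in>?\<S>. if S = S0 then \<Prod>i<p+q. clin (\<xi> i) (z i) else 0)"
  proof (intro sum.cong refl, goal_cases)
    case (1 S)
    have eq: "clin (part S i) (z i) = (if (i \<in> S) = (i \<in> S0) then clin (\<xi> i) (z i) else 0)"
      if "i < p + q" for i
      using clin_part[OF \<xi>[OF that] J, of "i \<in> S" "i \<in> S0" "v i"] z[OF that]
      by (simp add: part_def[abs_def])
    show ?case
    proof (cases "S = S0")
      case True
      then show ?thesis
        by (simp only: True if_True, intro prod.cong refl) (use eq True in auto)
    next
      case False
      then obtain i where "i < p + q" "(i \<in> S) \<noteq> (i \<in> S0)"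
        using 1 S0 by (metis (no_types, lifting) lessThan_iff mem_Collect_eq subset_iff subsetI subset_antisym)
      then show ?thesis
        using False by (auto intro!: bexI[of _ i] simp: eq)
    qed
  qed
  also have "\<dots> = cext (p+q) (\<lambda>v. \<Prod>i<p+q. \<xi> i (v i)) z"
    using S0 fin by (simp add: cext_prod)
  finally show ?thesis .
qed

lemma cext_type_component_det_form:
  fixes J :: "'v::real_vector \<Rightarrow> 'v"
  assumes \<xi>: "\<And>i. i < p + q \<Longrightarrow> linear (\<xi> i)" and J: "linear J" "\<And>v. J (J v) = - v"
    and S0: "S0 \<subseteq> {..<p+q}" "card S0 = p"
    and z: "\<And>i. i < p + q \<Longrightarrow> z i = (if i \<in> S0 then vec10 J (v i) else vec01 J (v i))"
  shows "cext (p+q) (type_component p q J (det_form (p+q) \<xi>)) z = det_form (p+q) (\<lambda>k. clin (\<xi> k)) z"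
proof -
  have "cext (p+q) (type_component p q J (det_form (p+q) \<xi>)) z =
     (\<Sum>a | a permutes {0..<p+q}. of_int (sign a) *
        cext (p+q) (type_component p q J (\<lambda>v. \<Prod>i<p+q. \<xi> (a i) (v i))) z)"
    unfolding det_form_expand[abs_def] type_component_sum cext_sum ..
  also have "\<dots> = (\<Sum>a | a permutes {0..<p+q}. of_int (sign a) *
        cext (p+q) (\<lambda>v. \<Prod>i<p+q. \<xi> (a i) (v i)) z)"
    using \<xi> by (intro sum.cong refl arg_cong2[of _ _ _ _ "(*)"] cext_type_component_prod[OF _ J S0 z])
      (auto simp: permutes_less)
  also have "\<dots> = det_form (p+q) (\<lambda>k. clin (\<xi> k)) z"
    unfolding det_form_expand[abs_def]
    by (intro sum.cong refl arg_cong2[of _ _ _ _ "(*)"] cext_prod)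
  finally show ?thesis .
qed

lemma type_component_full:
  "type_component p 0 J \<omega> v = cext p \<omega> (\<lambda>i. if i < p then vec10 J (v i) else vec01 J (v i))"
proof -
  have "{S. S \<subseteq> {..<p} \<and> card S = p} = {{..<p}}"
    by (auto dest: card_subset_eq[rotated])
  then show ?thesis
    by (simp add: type_component_def)
qed

lemma det_form_in_forms_of_type:
  assumes \<xi>: "\<And>k. k < n \<Longrightarrow> linear (\<xi> k)" and J: "\<And>k v. k < n \<Longrightarrow> \<xi> k (J v) = \<i> * \<xi> k v"
  shows "det_form n \<xi> \<in> forms_of_type n 0 J"
proof -
  have "clin (\<xi> k) (vec10 J v) = \<xi> k v" if "k < n" for k v
    using \<xi>[OF that] J[OF that]
    by (simp add: clin_def vec10_def linear_scale linear_neg scaleR_conv_of_real)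
  then have "type_component n 0 J (det_form n \<xi>) = det_form n \<xi>"
    unfolding type_component_full cext_det_form by (auto intro!: det_form_cong)
  then show ?thesis
    using \<xi> by (simp add: forms_of_type_def alternating_det_form)
qed

section \<open>Forms of type (n,0) are complex multilinear and determined by a frame\<close>

lemma cext_times_i:
  assumes \<omega>: "alternating_form n \<omega>" and i: "i < n"
  shows "cext n \<omega> (z(i := (- snd (z i), fst (z i)))) = \<i> * cext n \<omega> z"
proof -
  let ?B = "{..<n} - {i}"
  have split: "Pow {..<n} = Pow ?B \<union> insert i ` Pow ?B"
    using i Pow_insert[of i ?B] by (simp add: insert_absorb)
  have cext: "cext n \<omega> z = (\<Sum>T\<in>Pow ?B.
      \<i> ^ card T * \<omega> (\<lambda>j. if j = i then fst (z i) else if j \<in> T then snd (z j) else fst (z j)) +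
      \<i> ^ Suc (card T) * \<omega> (\<lambda>j. if j = i then snd (z i) else if j \<in> T then snd (z j) else fst (z j)))"
    for z
  proof -
    have "inj_on (insert i) (Pow ?B)"
      by (rule inj_onI) blast
    moreover have "card (insert i T) = Suc (card T)" if "T \<subseteq> ?B" for T
      using that by (subst card_insert_disjoint) (auto intro: finite_subset)
    ultimately show ?thesis
      unfolding cext_def split
      apply (subst sum.union_disjoint)
         apply (auto simp: sum.reindex sum.distrib[symmetric] intro!: sum.cong)
      apply (intro arg_cong2[of _ _ _ _ "(+)"] arg_cong2[of _ _ _ _ "(*)"] arg_cong[of _ _ \<omega>] refl; force)
      done
  qed
  have neg: "\<omega> (\<lambda>j. if j = i then - x else f j) = - \<omega> (\<lambda>j. if j = i then x else f j)" for x f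
  proof -
    have "linear (\<lambda>u. \<omega> (f(i := u)))"
      using \<omega> i by (auto simp: alternating_form_def)
    from linear_neg[OF this, of x] show ?thesis
      by (simp add: fun_upd_def)
  qed
  show ?thesis
    unfolding cext sum_distrib_left
    by (intro sum.cong refl) (simp add: neg algebra_simps cong: if_cong)
qed

text \<open>Complex multilinearity with respect to \<open>J\<close>: passing from \<open>v i\<close>
  to \<open>J (v i)\<close> multiplies the (1,0)-part by the imaginary unit, and \<open>cext\<close>
  is complex linear in each slot.\<close>

lemma forms_of_type_slot:
  assumes \<omega>: "\<omega> \<in> forms_of_type n 0 J" and J: "\<And>v. J (J v) = - v" and i: "i < n"
  shows "\<omega> (v(i := J (v i))) = \<i> * \<omega> v"
proof -
  have alt: "alternating_form n \<omega>" and eq: "type_component n 0 J \<omega> = \<omega>"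
    using \<omega> by (auto simp: forms_of_type_def)
  let ?z = "\<lambda>v i. if i < n then vec10 J (v i) else vec01 J (v i)"
  have "?z (v(i := J (v i))) = (?z v)(i := (- snd (?z v i), fst (?z v i)))"
    using i by (auto simp: fun_eq_iff vec10_def J)
  then show ?thesis
    using cext_times_i[OF alt i, of "?z v"] eq type_component_full[of n J \<omega>] by metis
qed

lemma alternating_swap:
  assumes \<omega>: "alternating_form n \<omega>" and ij: "i < n" "j < n" "i \<noteq> j"
  shows "\<omega> (v(i := v j, j := v i)) = - \<omega> v"
proof -
  have lin: "linear (\<lambda>u. \<omega> (w(k := u)))" if "k < n" for w k
    using \<omega> that by (auto simp: alternating_form_def)
  have rep: "\<omega> w = 0" if "w i = w j" for w
    using \<omega> that ij unfolding alternating_form_def by blast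
  let ?f = "\<lambda>a b. \<omega> (v(i := a, j := b))"
  have fi: "?f (a + a') b = ?f a b + ?f a' b" for a a' b
    using linear_add[OF lin[OF ij(1)], of "v(j := b)" a a'] ij by (simp add: fun_upd_twist)
  have fj: "?f a (b + b') = ?f a b + ?f a b'" for a b b'
    using linear_add[OF lin[OF ij(2)], of "v(i := a)" b b'] by simp
  have "?f (v i + v j) (v i + v j) = 0" "?f (v i) (v i) = 0" "?f (v j) (v j) = 0"
    using ij by (auto intro: rep)
  then have "?f (v j) (v i) + ?f (v i) (v j) = 0"
    by (simp only: fi fj) simp
  then show ?thesis
    using eq_neg_iff_add_eq_0[of "?f (v j) (v i)" "?f (v i) (v j)"] by simp
qed

text \<open>The top exterior power is a complex line. Multilinearity reduces arbitrary arguments to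
  frame vectors; a repeated frame vector gives zero, and otherwise the value is that on
  \<open>E\<close> up to sign.\<close>

lemma alternating_zero_on_frame:
  fixes E :: "nat \<Rightarrow> 'v::real_vector"
  assumes \<omega>: "alternating_form n \<omega>"
    and J: "\<And>v i. i < n \<Longrightarrow> \<omega> (v(i := J (v i))) = \<i> * \<omega> v"
    and span: "\<And>x. \<exists>a b. x = (\<Sum>l<n. a l *\<^sub>R E l + b l *\<^sub>R J (E l))"
    and 0: "\<omega> E = 0"
  shows "\<omega> v = 0"
proof -
  have lin: "linear (\<lambda>u. \<omega> (w(k := u)))" if "k < n" for w k
    using \<omega> that by (auto simp: alternating_form_def)
  have cong: "\<omega> w = \<omega> w'" if "\<And>i. i < n \<Longrightarrow> w i = w' i" for w w'
    using \<omega> that by (auto simp: alternating_form_def)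
  have perm: "\<omega> (E \<circ> p) = 0" if p: "p permutes {..<n}" for p
    using finite_lessThan p
  proof (induction p rule: permutes_rev_induct)
    case id
    then show ?case by (simp add: 0)
  next
    case (swap a b p)
    have "E \<circ> (p \<circ> Transposition.transpose a b) = (E \<circ> p)(a := (E \<circ> p) b, b := (E \<circ> p) a)"
      using swap.hyps by (auto simp: fun_eq_iff Transposition.transpose_def)
    moreover have "\<omega> ((E \<circ> p)(a := (E \<circ> p) b, b := (E \<circ> p) a)) = - \<omega> (E \<circ> p)"
      using swap.hyps by (intro alternating_swap[OF \<omega>]) auto
    ultimately show ?case
      unfolding swap.IH by (metis minus_zero)
  qed
  have tuple: "\<omega> (E \<circ> f) = 0" if f: "\<And>i. i < n \<Longrightarrow> f i < n" for f
  proof (cases "inj_on f {..<n}")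
    case True
    have "f ` {..<n} = {..<n}"
      using True f by (intro card_subset_eq) (auto simp: card_image)
    then have "(\<lambda>i. if i < n then f i else i) permutes {..<n}"
      using True by (intro bij_imp_permutes) (auto simp: bij_betw_def inj_on_def)
    then have "\<omega> (E \<circ> (\<lambda>i. if i < n then f i else i)) = 0"
      by (rule perm)
    moreover have "\<omega> (E \<circ> f) = \<omega> (E \<circ> (\<lambda>i. if i < n then f i else i))"
      by (rule cong) auto
    ultimately show ?thesis
      by metis
  next
    case False
    then obtain i j where "i < n" "j < n" "i \<noteq> j" "f i = f j"
      by (auto simp: inj_on_def)
    then show ?thesis
      using \<omega> unfolding alternating_form_def by (metis comp_apply)
  qed
  \<comment> \<open>Induction on the number \<open>m\<close> of leading arguments that are still
    arbitrary; those from \<open>m\<close> on are frame vectors.\<close>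
  have "\<omega> v = 0" if "m \<le> n" "\<And>i. m \<le> i \<Longrightarrow> i < n \<Longrightarrow> v i \<in> E ` {..<n}" for m v
    using that
  proof (induction m arbitrary: v)
    case 0
    then have "\<forall>i. \<exists>l. i < n \<longrightarrow> l < n \<and> v i = E l"
      by blast
    then obtain f where "\<forall>i. i < n \<longrightarrow> f i < n \<and> v i = E (f i)"
      by metis
    then have "\<omega> v = \<omega> (E \<circ> f)" "\<omega> (E \<circ> f) = 0"
      by (auto intro: cong tuple)
    then show ?case by simp
  next
    case (Suc m)
    then have m: "m < n" by simp
    have E0: "\<omega> (v(m := E l)) = 0" if "l < n" for l
      using Suc that by (intro Suc.IH) auto
    have "\<omega> (v(m := J (E l))) = 0" if "l < n" for l
      using J[OF m, of "v(m := E l)"] E0[OF that] by simp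
    moreover obtain a b where "v m = (\<Sum>l<n. a l *\<^sub>R E l + b l *\<^sub>R J (E l))"
      using span by blast
    ultimately have "\<omega> (v(m := v m)) = 0"
      by (simp add: E0 linear_sum[OF lin[OF m]] linear_add[OF lin[OF m]] linear_scale[OF lin[OF m]])
    then show ?case by simp
  qed
  from this[of n] show ?thesis by simp
qed

lemma alternating_form_diff:
  assumes "alternating_form n \<omega>" "alternating_form n \<omega>'"
  shows "alternating_form n (\<lambda>v. \<omega> v - c * \<omega>' v)"
proof -
  have "linear (\<lambda>u. \<omega> (v(i := u)) - c * \<omega>' (v(i := u)))" if "i < n" for v i
  proof -
    have "linear (\<lambda>u. \<omega> (v(i := u)))" "linear (\<lambda>u. \<omega>' (v(i := u)))"
      using assms that by (auto simp: alternating_form_def)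
    then show ?thesis
      using linear_compose[OF _ linear_times[of c], of "\<lambda>u. \<omega>' (v(i := u))"]
      by (auto intro!: linear_compose_sub simp: o_def)
  qed
  moreover have "\<omega> v - c * \<omega>' v = \<omega> v' - c * \<omega>' v'" if "\<forall>i<n. v i = v' i" for v v'
  proof -
    have "\<omega> v = \<omega> v'" "\<omega>' v = \<omega>' v'"
      using assms that unfolding alternating_form_def by blast+
    then show ?thesis by simp
  qed
  moreover have "\<omega> v - c * \<omega>' v = 0" if "i < n \<and> j < n \<and> i \<noteq> j \<and> v i = v j" for v i j
  proof -
    have "\<omega> v = 0" "\<omega>' v = 0"
      using assms that unfolding alternating_form_def by blast+
    then show ?thesis by simp
  qed
  ultimately show ?thesis
    unfolding alternating_form_def by blast
qed

section \<open>Calculus of smooth functions\<close>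

lemma Ck_on_cong:
  assumes "open S" "\<And>x. x \<in> S \<Longrightarrow> f x = g x" "Ck_on k S f"
  shows "Ck_on k S g"
  using assms(2,3)
proof (induction k arbitrary: f g)
  case 0
  then show ?case by (metis Ck_on.simps(1) continuous_on_cong)
next
  case (Suc k)
  have d: "f differentiable (at x)" if "x \<in> S" for x
    using Suc.prems(2) that assms(1) by (auto simp: differentiable_on_eq_differentiable_at)
  have "g differentiable (at x)" if x: "x \<in> S" for x
  proof -
    obtain D where "(f has_derivative D) (at x)"
      using d[OF x] unfolding differentiable_def by blast
    then have "(g has_derivative D) (at x)"
      by (rule has_derivative_transform_within_open[OF _ assms(1) x]) (rule Suc.prems(1))
    then show ?thesis by (rule differentiableI)
  qed
  then have "g differentiable_on S"
    by (simp add: differentiable_at_imp_differentiable_on)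
  moreover have "Ck_on k S (\<lambda>x. frechet_derivative g (at x) v)" for v
  proof (rule Suc.IH)
    show "frechet_derivative f (at x) v = frechet_derivative g (at x) v" if "x \<in> S" for x
      by (rule arg_cong[OF frechet_derivative_transform_within_open[OF d[OF that] assms(1) that]])
        (rule Suc.prems(1))
    show "Ck_on k S (\<lambda>x. frechet_derivative f (at x) v)"
      using Suc.prems(2) by simp
  qed
  ultimately show ?case by simp
qed

lemma Ck_on_subset: "Ck_on k S f \<Longrightarrow> T \<subseteq> S \<Longrightarrow> Ck_on k T f"
  by (induction k arbitrary: f) (auto intro: continuous_on_subset differentiable_on_subset)

lemma Ck_on_SucD: "Ck_on (Suc k) S f \<Longrightarrow> Ck_on k S f"
proof (induction k arbitrary: f)
  case 0
  then show ?case by (auto intro: differentiable_imp_continuous_on)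
next
  case (Suc k)
  then show ?case by (metis Ck_on.simps(2))
qed

text \<open>Together with \<open>Ck_on_SucE\<close> this allows explicit derivatives
  \<open>D x\<close> in place of the chosen \<open>frechet_derivative\<close>, which is how the
  closure properties below are proved.\<close>

lemma Ck_on_SucI:
  assumes "open S" "\<And>x. x \<in> S \<Longrightarrow> (f has_derivative D x) (at x)"
    and "\<And>v. Ck_on k S (\<lambda>x. D x v)"
  shows "Ck_on (Suc k) S f"
proof -
  have "f differentiable_on S"
    using differentiableI[OF assms(2)] by (simp add: differentiable_at_imp_differentiable_on)
  moreover have "Ck_on k S (\<lambda>x. frechet_derivative f (at x) v)" for v
    by (rule Ck_on_cong[OF assms(1) _ assms(3)[of v]]) (simp add: frechet_derivative_at[OF assms(2), symmetric])
  ultimately show ?thesis by simp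
qed

lemma Ck_on_SucE:
  assumes "open S" "Ck_on (Suc k) S f"
  obtains D where "\<And>x. x \<in> S \<Longrightarrow> (f has_derivative D x) (at x)" "\<And>v. Ck_on k S (\<lambda>x. D x v)"
proof
  show "(f has_derivative frechet_derivative f (at x)) (at x)" if "x \<in> S" for x
    using assms that by (auto simp: differentiable_on_eq_differentiable_at frechet_derivative_works)
  show "Ck_on k S (\<lambda>x. frechet_derivative f (at x) v)" for v
    using assms by simp
qed

lemma Ck_on_const: "open S \<Longrightarrow> Ck_on k S (\<lambda>x. c)"
proof (induction k arbitrary: c)
  case (Suc k)
  then show ?case by (intro Ck_on_SucI[where D = "\<lambda>_ _. 0"]) auto
qed simp

lemma Ck_on_add:
  assumes "open S"
  shows "Ck_on k S f \<Longrightarrow> Ck_on k S g \<Longrightarrow> Ck_on k S (\<lambda>x. f x + g x)"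
proof (induction k arbitrary: f g)
  case 0
  then show ?case by (auto intro: continuous_on_add)
next
  case (Suc k)
  obtain D where D: "\<And>x. x \<in> S \<Longrightarrow> (f has_derivative D x) (at x)" "\<And>v. Ck_on k S (\<lambda>x. D x v)"
    using Ck_on_SucE[OF assms Suc.prems(1)] by blast
  obtain D' where D': "\<And>x. x \<in> S \<Longrightarrow> (g has_derivative D' x) (at x)" "\<And>v. Ck_on k S (\<lambda>x. D' x v)"
    using Ck_on_SucE[OF assms Suc.prems(2)] by blast
  show ?case
    using D D' Suc.IH by (intro Ck_on_SucI[OF assms, where D = "\<lambda>x v. D x v + D' x v"])
      (auto intro: has_derivative_add)
qed

lemma Ck_on_mult:
  fixes f g :: "'a::euclidean_space \<Rightarrow> 'b::real_normed_field"
  assumes "open S"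
  shows "Ck_on k S f \<Longrightarrow> Ck_on k S g \<Longrightarrow> Ck_on k S (\<lambda>x. f x * g x)"
proof (induction k arbitrary: f g)
  case 0
  then show ?case by (auto intro: continuous_on_mult)
next
  case (Suc k)
  obtain D where D: "\<And>x. x \<in> S \<Longrightarrow> (f has_derivative D x) (at x)" "\<And>v. Ck_on k S (\<lambda>x. D x v)"
    using Ck_on_SucE[OF assms Suc.prems(1)] by blast
  obtain D' where D': "\<And>x. x \<in> S \<Longrightarrow> (g has_derivative D' x) (at x)" "\<And>v. Ck_on k S (\<lambda>x. D' x v)"
    using Ck_on_SucE[OF assms Suc.prems(2)] by blast
  show ?case
    using D D' Suc.IH Suc.prems[THEN Ck_on_SucD]
    by (intro Ck_on_SucI[OF assms, where D = "\<lambda>x v. f x * D' x v + D x v * g x"])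
      (auto intro: has_derivative_mult Ck_on_add[OF assms])
qed

lemma Ck_on_inverse:
  fixes f :: "'a::euclidean_space \<Rightarrow> 'b::real_normed_field"
  assumes "open S" "\<And>x. x \<in> S \<Longrightarrow> f x \<noteq> 0"
  shows "Ck_on k S f \<Longrightarrow> Ck_on k S (\<lambda>x. inverse (f x))"
proof (induction k)
  case 0
  then show ?case using assms(2) by (auto intro: continuous_on_inverse)
next
  case (Suc k)
  obtain D where D: "\<And>x. x \<in> S \<Longrightarrow> (f has_derivative D x) (at x)" "\<And>v. Ck_on k S (\<lambda>x. D x v)"
    using Ck_on_SucE[OF assms(1) Suc.prems] by blast
  have "Ck_on k S (\<lambda>x. (-1) * (inverse (f x) * D x v * inverse (f x)))" for v
    using Suc.IH[OF Ck_on_SucD[OF Suc.prems]] D(2)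
    by (intro Ck_on_mult[OF assms(1)] Ck_on_const[OF assms(1)])
  then show ?case
    using D(1) assms(2)
    by (intro Ck_on_SucI[OF assms(1), where D = "\<lambda>x v. - (inverse (f x) * D x v * inverse (f x))"])
      (auto intro: has_derivative_inverse)
qed

lemma Ck_on_exp_linear:
  fixes L :: "'a::euclidean_space \<Rightarrow> complex"
  assumes "linear L" "open S"
  shows "Ck_on k S (\<lambda>x. exp (L x))"
proof (induction k)
  case 0
  then show ?case
    using assms(1) by (simp add: continuous_on_exp linear_continuous_on linear_conv_bounded_linear)
next
  case (Suc k)
  have "(L has_derivative L) (at x)" for x
    using assms(1) by (simp add: linear_imp_has_derivative)
  then have "((\<lambda>x. exp (L x)) has_derivative (\<lambda>v. L v * exp (L x))) (at x)" for x
    using has_derivative_compose[OF _ DERIV_exp[unfolded has_field_derivative_def], of L L]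
    by (simp add: mult.commute)
  then show ?case
    using Suc by (intro Ck_on_SucI[OF assms(2), where D = "\<lambda>x v. L v * exp (L x)"]
        Ck_on_mult[OF assms(2)] Ck_on_const[OF assms(2)])
qed

lemma smooth_on_cong:
  "open S \<Longrightarrow> (\<And>x. x \<in> S \<Longrightarrow> f x = g x) \<Longrightarrow> smooth_on S f \<Longrightarrow> smooth_on S g"
  unfolding smooth_on_def by (auto intro: Ck_on_cong[of S f g])

lemma smooth_on_subset: "smooth_on S f \<Longrightarrow> T \<subseteq> S \<Longrightarrow> smooth_on T f"
  unfolding smooth_on_def using Ck_on_subset by blast

lemma smooth_on_differentiable:
  "smooth_on S f \<Longrightarrow> open S \<Longrightarrow> x \<in> S \<Longrightarrow> f differentiable (at x)"
  unfolding smooth_on_def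
  using Ck_on.simps(2)[of 0 S f] by (auto simp: differentiable_on_eq_differentiable_at)

lemma smooth_on_continuous: "smooth_on S f \<Longrightarrow> continuous_on S f"
  unfolding smooth_on_def using Ck_on.simps(1)[of S f] by blast

lemma smooth_on_const: "open S \<Longrightarrow> smooth_on S (\<lambda>x. c)"
  by (simp add: smooth_on_def Ck_on_const)

lemma smooth_on_add:
  "open S \<Longrightarrow> smooth_on S f \<Longrightarrow> smooth_on S g \<Longrightarrow> smooth_on S (\<lambda>x. f x + g x)"
  by (simp add: smooth_on_def Ck_on_add)

lemma smooth_on_mult:
  fixes f g :: "'a::euclidean_space \<Rightarrow> 'b::real_normed_field"
  shows "open S \<Longrightarrow> smooth_on S f \<Longrightarrow> smooth_on S g \<Longrightarrow> smooth_on S (\<lambda>x. f x * g x)"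
  by (simp add: smooth_on_def Ck_on_mult)

lemma smooth_on_divide:
  fixes f g :: "'a::euclidean_space \<Rightarrow> 'b::real_normed_field"
  assumes "open S" "smooth_on S f" "smooth_on S g" "\<And>x. x \<in> S \<Longrightarrow> g x \<noteq> 0"
  shows "smooth_on S (\<lambda>x. f x / g x)"
  using assms by (simp add: smooth_on_def Ck_on_mult Ck_on_inverse divide_inverse)

lemma smooth_on_exp_linear:
  fixes L :: "'a::euclidean_space \<Rightarrow> complex"
  shows "open S \<Longrightarrow> linear L \<Longrightarrow> smooth_on S (\<lambda>x. exp (L x))"
  by (simp add: smooth_on_def Ck_on_exp_linear)

lemma smooth_on_sum:
  assumes "open S" "\<And>i. i \<in> I \<Longrightarrow> smooth_on S (f i)"
  shows "smooth_on S (\<lambda>x. \<Sum>i\<in>I. f i x)"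
  using assms(2) by (induction I rule: infinite_finite_induct)
    (simp_all add: assms(1) smooth_on_const smooth_on_add)

lemma smooth_on_prod:
  fixes f :: "'i \<Rightarrow> 'a::euclidean_space \<Rightarrow> 'b::real_normed_field"
  assumes "open S" "\<And>i. i \<in> I \<Longrightarrow> smooth_on S (f i)"
  shows "smooth_on S (\<lambda>x. \<Prod>i\<in>I. f i x)"
  using assms(2) by (induction I rule: infinite_finite_induct)
    (simp_all add: assms(1) smooth_on_const smooth_on_mult)

text \<open>In the applications \<open>q\<close> is the volume form, or a power of it, evaluated on
  the frame frozen at \<open>x\<close>. It is 1 at \<open>x\<close> but may vanish elsewhere, so the
  domain has to shrink.\<close>

lemma smooth_quotient_near:
  fixes p q h :: "'a::euclidean_space \<Rightarrow> complex"
  assumes "open U" "x \<in> U" "smooth_on U p" "smooth_on U q" "q x \<noteq> 0"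
    and "\<And>y. y \<in> U \<Longrightarrow> h y * q y = p y"
  obtains U' where "open U'" "x \<in> U'" "U' \<subseteq> U" "smooth_on U' h"
proof
  let ?U = "U \<inter> q -` (- {0})"
  show "open ?U"
    using assms by (intro continuous_open_preimage smooth_on_continuous) auto
  show "x \<in> ?U" "?U \<subseteq> U"
    using assms by auto
  have "smooth_on ?U (\<lambda>y. p y / q y)"
    using assms \<open>open ?U\<close> by (intro smooth_on_divide) (auto intro: smooth_on_subset)
  then show "smooth_on ?U h"
    by (rule smooth_on_cong[OF \<open>open ?U\<close>, rotated]) (use assms(6) in \<open>auto simp: field_simps\<close>)
qed

section \<open>The Cauchy-Riemann operator in a frame\<close>

text \<open>For \<open>D\<close> the differential of a function this is its (0,1)-part, that is
  \<open>clin D (vec01 Jx u)\<close>. It vanishes exactly when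
  \<open>D (Jx u) = \<i> * D u\<close>.\<close>

definition dbar_fun ::
  "('v::real_normed_vector \<Rightarrow> 'v) \<Rightarrow> ('v \<Rightarrow> complex) \<Rightarrow> 'v \<Rightarrow> complex" where
  "dbar_fun Jx D u = (D u + \<i> * D (Jx u)) / 2"

text \<open>The structure equation \<open>d \<theta>\<^sub>k = c\<^sub>k \<and> \<theta>\<^sub>k + \<tau> \<and> \<zeta>\<^sub>k\<close> with \<open>\<Sum>\<^sub>k c\<^sub>k = 0\<close>, with \<open>\<zeta>\<^sub>k\<close> of type
  \<open>(0,1)\<close>, and with \<open>\<zeta>\<^sub>k = 0\<close> for those \<open>k\<close> that enter the \<open>(1,0)\<close>-part \<open>\<Sum>\<^sub>k t\<^sub>k \<theta>\<^sub>k\<close> of \<open>\<tau>\<close>,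
  is what makes the volume form \<open>\<theta>\<^sub>0 \<and> \<dots> \<and> \<theta>\<^bsub>d-1\<^esub>\<close> holomorphic although \<open>J\<close> is not integrable.\<close>

locale unimodular_frame =
  fixes d :: nat
    and J :: "'v::euclidean_space \<Rightarrow> 'v \<Rightarrow> 'v"
    and \<theta> :: "'v \<Rightarrow> nat \<Rightarrow> 'v \<Rightarrow> complex"
    and E :: "'v \<Rightarrow> nat \<Rightarrow> 'v"
    and c :: "nat \<Rightarrow> 'v \<Rightarrow> complex"
    and \<tau> :: "'v \<Rightarrow> complex"
    and \<zeta> :: "'v \<Rightarrow> nat \<Rightarrow> 'v \<Rightarrow> complex"
    and t :: "nat \<Rightarrow> complex"
  assumes d: "cdim TYPE('v) = d"
    and linear_J: "linear (J x)"
    and J_J: "J x (J x v) = - v"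
    and linear_\<theta>: "k < d \<Longrightarrow> linear (\<theta> x k)"
    and \<theta>_J: "k < d \<Longrightarrow> \<theta> x k (J x v) = \<i> * \<theta> x k v"
    and \<theta>_E: "k < d \<Longrightarrow> l < d \<Longrightarrow> \<theta> x k (E x l) = (if k = l then 1 else 0)"
    and \<theta>_inj: "(\<And>k. k < d \<Longrightarrow> \<theta> x k v = 0) \<Longrightarrow> v = 0"
    and smooth_\<theta>: "k < d \<Longrightarrow> smooth_on UNIV (\<lambda>x. \<theta> x k v)"
    and derivative_\<theta>: "k < d \<Longrightarrow>
      ((\<lambda>y. \<theta> y k v) has_derivative (\<lambda>h. c k h * \<theta> x k v + \<tau> h * \<zeta> x k v)) (at x)"
    and trace_0: "(\<Sum>k<d. c k h) = 0"
    and linear_\<tau>: "linear \<tau>"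
    and linear_\<zeta>: "k < d \<Longrightarrow> linear (\<zeta> x k)"
    and \<zeta>_J: "k < d \<Longrightarrow> \<zeta> x k (J x v) = - \<i> * \<zeta> x k v"
    and \<tau>_10: "clin \<tau> (vec10 (J x) v) = (\<Sum>k<d. t k * \<theta> x k v)"
    and t_\<zeta>: "k < d \<Longrightarrow> t k \<noteq> 0 \<Longrightarrow> \<zeta> x k v = 0"
begin

section \<open>The volume form of a unimodular frame and its derivative\<close>

definition \<Phi> :: "'v \<Rightarrow> 'v form" where
  "\<Phi> x = det_form d (\<theta> x)"

lemma \<Phi>_E: "\<Phi> x (E x) = 1"
proof -
  have "Matrix.mat d d (\<lambda>(i, k). \<theta> x k (E x i)) = 1\<^sub>m d"
    by (auto intro!: eq_matI simp: \<theta>_E)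
  then show ?thesis
    by (simp add: \<Phi>_def det_form_def)
qed

lemma \<Phi>_in_canonical_fibre: "\<Phi> x \<in> canonical_fibre (J x)"
  unfolding \<Phi>_def canonical_fibre_def d
  by (intro det_form_in_forms_of_type linear_\<theta> \<theta>_J)

text \<open>The canonical fibre is a line spanned by \<open>\<Phi> x\<close>: the difference of the
  two sides is complex multilinear, alternating, and zero on the frame \<open>E x\<close>.\<close>

lemma canonical_fibre_eq:
  assumes "\<omega> \<in> canonical_fibre (J x)"
  shows "\<omega> v = \<omega> (E x) * \<Phi> x v"
proof -
  have \<omega>: "\<omega> \<in> forms_of_type d 0 (J x)" and \<Phi>: "\<Phi> x \<in> forms_of_type d 0 (J x)"
    using assms \<Phi>_in_canonical_fibre[of x] by (auto simp: canonical_fibre_def d)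
  have "\<omega> v - \<omega> (E x) * \<Phi> x v = 0"
  proof (rule alternating_zero_on_frame[where J = "J x" and E = "E x"])
    show "alternating_form d (\<lambda>v. \<omega> v - \<omega> (E x) * \<Phi> x v)"
      using \<omega> \<Phi> by (intro alternating_form_diff) (auto simp: forms_of_type_def)
    show "\<omega> (v(i := J x (v i))) - \<omega> (E x) * \<Phi> x (v(i := J x (v i))) =
        \<i> * (\<omega> v - \<omega> (E x) * \<Phi> x v)" if "i < d" for v i
      using forms_of_type_slot[OF \<omega> J_J that] forms_of_type_slot[OF \<Phi> J_J that]
      by (simp add: algebra_simps)
    show "\<omega> (E x) - \<omega> (E x) * \<Phi> x (E x) = 0"
      by (simp add: \<Phi>_E)
    show "\<exists>a b. v = (\<Sum>l<d. a l *\<^sub>R E x l + b l *\<^sub>R J x (E x l))" for v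
    proof (intro exI)
      \<comment> \<open>The complex coordinate \<open>\<theta> x l v\<close> splits into a real
        coefficient of \<open>E x l\<close> and one of its image under \<open>J x\<close>;
        \<open>\<theta>_inj\<close> then identifies the two vectors.\<close>
      let ?w = "\<Sum>l<d. Re (\<theta> x l v) *\<^sub>R E x l + Im (\<theta> x l v) *\<^sub>R J x (E x l)"
      have "\<theta> x k (v - ?w) = 0" if k: "k < d" for k
      proof -
        have "of_real (Re a) + \<i> * of_real (Im a) = a" for a
          by (simp add: complex_eq_iff)
        then have "\<theta> x k ?w = (\<Sum>l<d. if k = l then \<theta> x l v else 0)"
          using k unfolding linear_sum[OF linear_\<theta>[OF k]]
          by (intro sum.cong refl)
            (auto simp: linear_add[OF linear_\<theta>] linear_scale[OF linear_\<theta>] \<theta>_J \<theta>_E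
              scaleR_conv_of_real mult.commute)
        then show ?thesis
          using k by (simp add: linear_diff[OF linear_\<theta>[OF k]])
      qed
      then show "v = ?w"
        using \<theta>_inj[of x "v - ?w"] by simp
    qed
  qed
  then show ?thesis by simp
qed

lemma smooth_\<Phi>: "smooth_on UNIV (\<lambda>y. \<Phi> y v)"
  unfolding \<Phi>_def det_form_expand
  by (intro smooth_on_sum smooth_on_mult smooth_on_prod smooth_on_const smooth_\<theta> open_UNIV)
    (auto simp: permutes_less)

text \<open>Differentiate one column at a time. The diagonal terms each reproduce \<Phi> with factor
  \<open>c k h\<close>, and these factors add up to 0 by \<open>trace_0\<close>; only the columns
  replaced by torsion remain.\<close>

lemma \<Phi>_derivative:
  "((\<lambda>y. \<Phi> y v) has_derivative (\<lambda>h. \<tau> h * (\<Sum>k<d. det_form d ((\<theta> x)(k := \<zeta> x k)) v))) (at x)"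
proof -
  let ?D = "\<lambda>k h v. c k h * \<theta> x k v + \<tau> h * \<zeta> x k v"
  have "((\<lambda>y. \<Phi> y v) has_derivative (\<lambda>h. \<Sum>p | p permutes {0..<d}. of_int (sign p) *
      (\<Sum>k<d. ?D k h (v (p k)) * (\<Prod>j\<in>{..<d}-{k}. \<theta> x j (v (p j)))))) (at x)"
    unfolding \<Phi>_def det_form_expand_columns
    by (intro has_derivative_sum has_derivative_mult_right has_derivative_prod derivative_\<theta>) auto
  moreover have "(\<Sum>p | p permutes {0..<d}. of_int (sign p) *
      (\<Sum>k<d. ?D k h (v (p k)) * (\<Prod>j\<in>{..<d}-{k}. \<theta> x j (v (p j))))) =
      \<tau> h * (\<Sum>k<d. det_form d ((\<theta> x)(k := \<zeta> x k)) v)" for h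
  proof -
    have "(\<Sum>p | p permutes {0..<d}. of_int (sign p) *
        (\<Sum>k<d. ?D k h (v (p k)) * (\<Prod>j\<in>{..<d}-{k}. \<theta> x j (v (p j))))) =
        (\<Sum>k<d. det_form d ((\<theta> x)(k := ?D k h)) v)"
    proof -
      have "(\<Prod>j<d. ((\<theta> x)(k := ?D k h)) j (v (p j))) =
          ?D k h (v (p k)) * (\<Prod>j\<in>{..<d}-{k}. \<theta> x j (v (p j)))" if "k < d" for k p
        using that by (subst prod.remove[of _ k]) (auto intro!: prod.cong)
      then show ?thesis
        unfolding det_form_expand_columns sum_distrib_left
        by (subst sum.swap) (auto intro!: sum.cong)
    qed
    also have "\<dots> = (\<Sum>k<d. c k h * \<Phi> x v + \<tau> h * det_form d ((\<theta> x)(k := \<zeta> x k)) v)"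
      unfolding \<Phi>_def by (intro sum.cong refl) (simp add: det_form_column_add fun_upd_idem)
    also have "\<dots> = \<tau> h * (\<Sum>k<d. det_form d ((\<theta> x)(k := \<zeta> x k)) v)"
      using trace_0[of h] by (simp add: sum.distrib sum_distrib_left sum_distrib_right[symmetric])
    finally show ?thesis .
  qed
  ultimately show ?thesis by simp
qed

section \<open>The (d,1)-part of the exterior derivative\<close>

lemma clin_\<theta>:
  assumes "k < d"
  shows "clin (\<theta> x k) (vec10 (J x) v) = \<theta> x k v" "clin (\<theta> x k) (vec01 (J x) v) = 0"
  using assms
  by (simp_all add: clin_def vec10_def vec01_def linear_scale[OF linear_\<theta>] linear_neg[OF linear_\<theta>]
      \<theta>_J scaleR_conv_of_real)

lemma clin_\<zeta>:
  assumes "k < d"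
  shows "clin (\<zeta> x k) (vec10 (J x) v) = 0"
  using assms
  by (simp add: clin_def vec10_def linear_scale[OF linear_\<zeta>] linear_neg[OF linear_\<zeta>]
      \<zeta>_J scaleR_conv_of_real)

text \<open>Evaluated on one \<open>(0,1)\<close>-vector followed by \<open>d\<close> vectors of type \<open>(1,0)\<close>, the column of \<open>\<tau>\<close> is
  a combination of those of the \<open>\<theta>\<^sub>l\<close>, \<open>l \<noteq> k\<close>, and of that of \<open>\<zeta>\<^sub>k\<close>.\<close>

lemma torsion_type:
  assumes k: "k < d"
  shows "det_form (Suc d) (\<lambda>l. clin (case_nat \<tau> ((\<theta> x)(k := \<zeta> x k)) l))
    (case_nat (vec01 (J x) u) (\<lambda>j. vec10 (J x) (v j))) = 0"
    (is "det_form (Suc d) ?\<xi> ?z = 0")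
proof -
  let ?a = "clin (\<zeta> x k) (vec01 (J x) u)"
  show ?thesis
  proof (cases "?a = 0")
    case True
    have "?\<xi> (Suc k) (?z i) = 0" for i
      using True clin_\<zeta>[OF k] by (cases i) auto
    then show ?thesis
      using k by (intro det_form_singular[of "Suc k" _ "\<lambda>l. if l = Suc k then 1 else 0"])
        (auto simp: if_distrib if_distribR cong: if_cong)
  next
    case False
    have tk: "t k = 0"
    proof (rule ccontr)
      assume "t k \<noteq> 0"
      then have "\<zeta> x k v = 0" for v
        using t_\<zeta>[OF k] by blast
      then show False
        using False by (simp add: clin_def)
    qed
    \<comment> \<open>The relation is \<tau> - b \<open>\<zeta> x k\<close> - sum of
      \<open>t l * \<theta> x l\<close>. The value of \<open>b\<close> makes it hold on the
      (0,1)-vector, where the \<theta>'s vanish; on (1,0)-vectors it is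
      \<open>\<tau>_10\<close>.\<close>
    define b where "b = clin \<tau> (vec01 (J x) u) / ?a"
    define e where "e = case_nat 1 (\<lambda>l. if l = k then - b else - t l)"
    show ?thesis
    proof (rule det_form_singular[of 0 _ e])
      show "0 < Suc d" "e 0 \<noteq> 0"
        by (simp_all add: e_def)
      fix i
      assume i: "i < Suc d"
      have split: "(\<Sum>l<Suc d. e l * ?\<xi> l (?z i)) =
          clin \<tau> (?z i) - b * clin (\<zeta> x k) (?z i) - (\<Sum>l\<in>{..<d}-{k}. t l * clin (\<theta> x l) (?z i))"
        using k unfolding sum.lessThan_Suc_shift
        by (subst sum.remove[of _ k]) (auto simp: e_def sum_negf intro!: sum.cong)
      show "(\<Sum>l<Suc d. e l * ?\<xi> l (?z i)) = 0"
      proof (cases i)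
        case 0
        then show ?thesis
          using False unfolding split by (simp add: b_def clin_\<theta>)
      next
        case (Suc j)
        have "(\<Sum>l<d. t l * \<theta> x l (v j)) = (\<Sum>l\<in>{..<d}-{k}. t l * \<theta> x l (v j))"
          using k tk by (subst sum.remove[of _ k]) auto
        then show ?thesis
          using Suc unfolding split by (simp add: clin_\<theta> clin_\<zeta>[OF k] \<tau>_10)
      qed
    qed
  qed
qed

text \<open>Expand along the column of \<open>D\<close>. Every minor that keeps the row of the
  (0,1)-vector is zero, because all \<theta>'s vanish on that vector, so only the term with
  \<open>i = 0\<close> survives.\<close>

lemma volume_type:
  assumes D: "linear D"
  shows "det_form (Suc d) (\<lambda>l. clin (case_nat D (\<theta> x) l))
    (case_nat (vec01 (J x) u) (\<lambda>j. vec10 (J x) (v j))) = dbar_fun (J x) D u * \<Phi> x v"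
    (is "det_form (Suc d) ?\<xi> ?z = _")
proof -
  have "det_form d (\<lambda>k. ?\<xi> (Suc k)) (\<lambda>j. if j < i then ?z j else ?z (Suc j)) =
      (if i = 0 then \<Phi> x v else 0)" if i: "i \<le> d" for i
  proof (cases i)
    case 0
    then show ?thesis
      by (auto simp: \<Phi>_def clin_\<theta> intro!: det_form_cong)
  next
    case (Suc i')
    let ?w = "\<lambda>j. if j < i then ?z j else ?z (Suc j)"
    have zero: "clin (\<theta> x k) (?w 0) = 0" if "k < d" for k
      using that Suc by (simp add: clin_\<theta>)
    have "det_form d (\<lambda>k. ?\<xi> (Suc k)) ?w = 0"
    proof -
      have "(\<Prod>j<d. ?\<xi> (Suc (p j)) (?w j)) = 0" if "p permutes {0..<d}" for p
      proof (rule prod_zero)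
        show "\<exists>j\<in>{..<d}. ?\<xi> (Suc (p j)) (?w j) = 0"
          using zero[of "p 0"] permutes_less[OF that, of 0] Suc i by (intro bexI[of _ 0]) auto
      qed simp
      then show ?thesis
        unfolding det_form_expand by (intro sum.neutral) auto
    qed
    then show ?thesis
      using Suc by simp
  qed
  then have "det_form (Suc d) ?\<xi> ?z =
      (\<Sum>i\<le>d. (-1) ^ i * (?\<xi> 0 (?z i) * (if i = 0 then \<Phi> x v else 0)))"
    unfolding det_form_Suc by (intro sum.cong refl) auto
  also have "\<dots> = clin D (vec01 (J x) u) * \<Phi> x v"
    by (subst sum.atMost_shift) simp
  also have "clin D (vec01 (J x) u) = dbar_fun (J x) D u"
    by (simp add: clin_def vec01_def dbar_fun_def linear_scale[OF D] scaleR_conv_of_real field_simps)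
  finally show ?thesis .
qed

text \<open>The exterior derivative of g \<Phi> is dg \<and> \<Phi> plus g times the torsion
  determinants; the latter have no (d,1)-part. The structure \<open>J'\<close> stands for a local
  expression that is known to agree with \<open>J\<close> only on a chart.\<close>

lemma dbar_multiple:
  assumes U: "open U" "x \<in> U" and J': "J' x = J x"
    and \<eta>: "\<And>y. y \<in> U \<Longrightarrow> \<eta> y = (\<lambda>v. g y * \<Phi> y v)"
    and g: "(g has_derivative D) (at x)"
  shows "dbar J' \<eta> x u v = dbar_fun (J x) D u * \<Phi> x v"
proof -
  have D: "linear D"
    using g by (simp add: has_derivative_linear)
  let ?\<xi> = "\<lambda>k. case_nat \<tau> ((\<theta> x)(k := \<zeta> x k))"
  \<comment> \<open>The index \<open>None\<close> is the term dg \<and> \<Phi>, and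
    \<open>Some k\<close> is the torsion term of column \<open>k\<close>. One common sum lets
    \<open>type_component_sum\<close> and \<open>cext_sum\<close> act on all terms at once.\<close>
  define \<Xi> where "\<Xi> = (\<lambda>k::nat option. case k of None \<Rightarrow> case_nat D (\<theta> x) | Some k \<Rightarrow> ?\<xi> k)"
  define C where "C = (\<lambda>k::nat option. case k of None \<Rightarrow> 1 | Some k \<Rightarrow> g x)"
  define I where "I = insert None (Some ` {..<d})"
  have sumI: "(\<Sum>a\<in>I. f a) = f None + (\<Sum>k<d. f (Some k))" for f :: "nat option \<Rightarrow> complex"
    unfolding I_def by (subst sum.insert) (auto simp: sum.reindex)
  have "ext_deriv d \<eta> x = (\<lambda>w. \<Sum>a\<in>I. C a * det_form (Suc d) (\<Xi> a) w)"
  proof (rule ext)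
    fix w
    have "frechet_derivative (\<lambda>y. \<eta> y w') (at x) h =
        D h * \<Phi> x w' + g x * (\<tau> h * (\<Sum>k<d. det_form d ((\<theta> x)(k := \<zeta> x k)) w'))" for w' h
    proof -
      have "((\<lambda>y. g y * \<Phi> y w') has_derivative
          (\<lambda>h. g x * (\<tau> h * (\<Sum>k<d. det_form d ((\<theta> x)(k := \<zeta> x k)) w')) + D h * \<Phi> x w')) (at x)"
        by (intro has_derivative_mult g \<Phi>_derivative)
      then have "((\<lambda>y. \<eta> y w') has_derivative
          (\<lambda>h. g x * (\<tau> h * (\<Sum>k<d. det_form d ((\<theta> x)(k := \<zeta> x k)) w')) + D h * \<Phi> x w')) (at x)"
        by (rule has_derivative_transform_within_open[OF _ U]) (simp add: \<eta>)
      from frechet_derivative_at[OF this, symmetric] show ?thesis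
        by simp
    qed
    then have "ext_deriv d \<eta> x w = (\<Sum>i\<le>d. (-1) ^ i * (D (w i) * \<Phi> x (\<lambda>j. if j < i then w j else w (Suc j)))
        + (\<Sum>k<d. g x * ((-1) ^ i * (\<tau> (w i) *
            det_form d ((\<theta> x)(k := \<zeta> x k)) (\<lambda>j. if j < i then w j else w (Suc j))))))"
      unfolding ext_deriv_def by (simp add: algebra_simps sum_distrib_left)
    also have "\<dots> = det_form (Suc d) (case_nat D (\<theta> x)) w + (\<Sum>k<d. g x * det_form (Suc d) (?\<xi> k) w)"
      unfolding sum.distrib
      by (subst sum.swap[of _ "{..<d}" "{..d}"])
        (simp add: det_form_Suc \<Phi>_def sum_distrib_left fun_upd_def)
    also have "\<dots> = (\<Sum>a\<in>I. C a * det_form (Suc d) (\<Xi> a) w)"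
      by (simp add: sumI C_def \<Xi>_def)
    finally show "ext_deriv d \<eta> x w = (\<Sum>a\<in>I. C a * det_form (Suc d) (\<Xi> a) w)" .
  qed
  moreover have lin: "linear (\<Xi> a i)" if "a \<in> I" "i < d + 1" for a i
    using that D linear_\<theta> linear_\<zeta> linear_\<tau> by (auto simp: I_def \<Xi>_def split: nat.split)
  let ?z = "case_nat (vec01 (J x) u) (\<lambda>j. vec10 (J x) (v j))"
  have "cext (d + 1) (type_component d 1 (J x) (det_form (d + 1) (\<Xi> a))) ?z =
      det_form (d + 1) (\<lambda>l. clin (\<Xi> a l)) ?z" if "a \<in> I" for a
    \<comment> \<open>Argument 0 is the (0,1)-vector, so the (1,0)-positions are
      \<open>{1..d}\<close>.\<close>
    by (rule cext_type_component_det_form[where ?S0.0 = "{1..d}" and v = "case_nat u v"])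
      (use that in \<open>auto simp: lin linear_J J_J split: nat.split\<close>)
  ultimately have "dbar J' \<eta> x u v = (\<Sum>a\<in>I. C a * det_form (Suc d) (\<lambda>l. clin (\<Xi> a l)) ?z)"
    by (simp add: dbar_def d J' type_component_sum cext_sum Let_def)
  also have "\<dots> = dbar_fun (J x) D u * \<Phi> x v"
    using torsion_type volume_type[OF D] by (simp add: sumI C_def \<Xi>_def)
  finally show ?thesis .
qed

text \<open>The frame \<open>E\<close> is only known pointwise, so differentiability of the
  coefficient \<open>\<eta> y (E y)\<close> is obtained by evaluating on the fixed vectors
  \<open>E x\<close> and dividing by the volume form there.\<close>

lemma canonical_form_multiple:
  assumes U: "open U" "x \<in> U" and J': "\<And>y. y \<in> U \<Longrightarrow> J' y = J y"
    and \<eta>: "smooth_canonical_form J' U \<eta>"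
  shows "\<And>y. y \<in> U \<Longrightarrow> \<eta> y = (\<lambda>v. \<eta> y (E y) * \<Phi> y v)"
    and "(\<lambda>y. \<eta> y (E y)) differentiable (at x)"
proof -
  show *: "\<eta> y = (\<lambda>v. \<eta> y (E y) * \<Phi> y v)" if "y \<in> U" for y
  proof (rule ext, rule canonical_fibre_eq)
    have "\<eta> y \<in> canonical_fibre (J' y)"
      using \<eta> that by (simp add: smooth_canonical_form_def)
    then show "\<eta> y \<in> canonical_fibre (J y)"
      using J'[OF that] by simp
  qed
  have a: "\<eta> y (E y) * \<Phi> y (E x) = \<eta> y (E x)" if "y \<in> U" for y
    using *[OF that, THEN fun_cong, of "E x"] by simp
  have b: "smooth_on U (\<lambda>y. \<eta> y (E x))"
    using \<eta> by (simp add: smooth_canonical_form_def)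
  have c: "smooth_on U (\<lambda>y. \<Phi> y (E x))"
    using smooth_\<Phi> smooth_on_subset by blast
  have "\<Phi> x (E x) \<noteq> 0"
    by (simp add: \<Phi>_E)
  then obtain U' where "open U'" "x \<in> U'" "U' \<subseteq> U" "smooth_on U' (\<lambda>y. \<eta> y (E y))"
    by (rule smooth_quotient_near[OF U b c _ a])
  then show "(\<lambda>y. \<eta> y (E y)) differentiable (at x)"
    by (intro smooth_on_differentiable)
qed

text \<open>Any local expression of \<open>s\<close> has factors g \<Phi>, and then F is the sum of
  the products of the g's. The product rule for F turns the Leibniz sum into the stated value,
  whatever expression was chosen, so the description in \<open>dbar_power\<close> is unique.\<close>

lemma dbar_power_multiple:
  assumes r: "r > 0" and W: "open W" "x \<in> W" and J': "\<And>y. y \<in> W \<Longrightarrow> J' y = J y"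
    and F: "smooth_on W F" and s: "\<And>y. y \<in> W \<Longrightarrow> s y = (\<lambda>v. F y * (\<Prod>i<r. \<Phi> y (v i)))"
  shows "dbar_power r J' s x =
    (\<lambda>u v. dbar_fun (J x) (frechet_derivative F (at x)) u * (\<Prod>i<r. \<Phi> x (v i)))"
  unfolding dbar_power_def
proof (rule the_equality)
  let ?P = "\<lambda>t U (N::nat) \<eta>. open U \<and> x \<in> U \<and>
        (\<forall>k<N. \<forall>i<r. smooth_canonical_form J' U (\<eta> k i)) \<and>
        (\<forall>y\<in>U. s y = (\<lambda>v. \<Sum>k<N. pure_tensor r (\<lambda>i. \<eta> k i y) v)) \<and>
        t = (\<lambda>u v. \<Sum>k<N. \<Sum>i<r.
               dbar J' (\<eta> k i) x u (v i) * (\<Prod>j\<in>{..<r} - {i}. \<eta> k j x (v j)))"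
  let ?t = "\<lambda>u v. dbar_fun (J x) (frechet_derivative F (at x)) u * (\<Prod>i<r. \<Phi> x (v i))"
  have unique: "t = ?t" if "?P t U N \<eta>" for t U N \<eta>
  proof -
    \<comment> \<open>The neighbourhood \<open>U\<close> of an arbitrary local expression may leave
      \<open>W\<close>, outside of which nothing is known about \<open>s\<close> and
      \<open>J'\<close>.\<close>
    define V where "V = U \<inter> W"
    have V: "open V" "x \<in> V" and JV: "\<And>y. y \<in> V \<Longrightarrow> J' y = J y"
      using that W J' by (auto simp: V_def)
    have smooth: "smooth_canonical_form J' V (\<eta> k i)" if "k < N" "i < r" for k i
      using \<open>?P t U N \<eta>\<close> that
      by (auto simp: smooth_canonical_form_def V_def intro: smooth_on_subset[where S = U])
    define g where "g k i y = \<eta> k i y (E y)" for k i y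
    have \<eta>: "\<eta> k i y = (\<lambda>v. g k i y * \<Phi> y v)" if "k < N" "i < r" "y \<in> V" for k i y
      using canonical_form_multiple(1)[OF V JV smooth[OF that(1,2)] that(3)] by (simp add: g_def)
    define D where "D k i = frechet_derivative (g k i) (at x)" for k i
    have D: "(g k i has_derivative D k i) (at x)" if "k < N" "i < r" for k i
      using canonical_form_multiple(2)[OF V JV smooth[OF that]]
      by (simp add: D_def g_def[abs_def] frechet_derivative_works)
    have "(\<Sum>k<N. \<Prod>i<r. g k i y) = F y" if "y \<in> V" for y
    proof -
      have "(\<Sum>k<N. pure_tensor r (\<lambda>i. \<eta> k i y) v) = F y * (\<Prod>i<r. \<Phi> y (v i))" for v
        using \<open>?P t U N \<eta>\<close> s[of y] that by (auto simp: V_def fun_eq_iff)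
      \<comment> \<open>On the frame every factor \<Phi> equals 1, so only the coefficients
        remain.\<close>
      from this[of "\<lambda>_. E y"] show ?thesis
        using \<eta> that by (simp add: pure_tensor_def \<Phi>_E)
    qed
    moreover have "((\<lambda>y. \<Sum>k<N. \<Prod>i<r. g k i y) has_derivative
        (\<lambda>h. \<Sum>k<N. \<Sum>i<r. D k i h * (\<Prod>j\<in>{..<r}-{i}. g k j x))) (at x)"
      by (intro has_derivative_sum has_derivative_prod D) auto
    ultimately have "(F has_derivative (\<lambda>h. \<Sum>k<N. \<Sum>i<r. D k i h * (\<Prod>j\<in>{..<r}-{i}. g k j x))) (at x)"
      using has_derivative_transform_within_open[OF _ V] by blast
    then have DF: "frechet_derivative F (at x) =
        (\<lambda>h. \<Sum>k<N. \<Sum>i<r. D k i h * (\<Prod>j\<in>{..<r}-{i}. g k j x))"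
      by (rule frechet_derivative_at[symmetric])
    have dbar: "dbar J' (\<eta> k i) x u v = dbar_fun (J x) (D k i) u * \<Phi> x v" if "k < N" "i < r" for k i u v
      using V JV[OF V(2)] \<eta>[OF that] D[OF that]
      by (rule dbar_multiple[where g = "g k i" and U = V and D = "D k i"])
    have "t u v = ?t u v" for u v
    proof -
      have "t u v = (\<Sum>k<N. \<Sum>i<r. (dbar_fun (J x) (D k i) u * \<Phi> x (v i)) *
          (\<Prod>j\<in>{..<r} - {i}. g k j x * \<Phi> x (v j)))"
        using \<open>?P t U N \<eta>\<close> V
        by (auto simp: \<eta> dbar intro!: sum.cong prod.cong)
      also have "\<dots> = (\<Sum>k<N. \<Sum>i<r. (dbar_fun (J x) (D k i) u *
          (\<Prod>j\<in>{..<r} - {i}. g k j x)) * (\<Prod>j<r. \<Phi> x (v j)))"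
        by (intro sum.cong refl)
          (simp add: prod.distrib prod.remove[of "{..<r}"] mult_ac)
      also have "\<dots> = ?t u v"
        unfolding DF dbar_fun_def sum_distrib_right[symmetric]
        by (simp add: sum_distrib_left sum_distrib_right sum.distrib[symmetric] sum_divide_distrib field_simps)
      finally show ?thesis .
    qed
    then show ?thesis by blast
  qed
  show "\<exists>U N \<eta>. ?P ?t U N \<eta>"
  proof -
    \<comment> \<open>A single pure tensor suffices: the coefficient \<open>F\<close> goes into
      factor 0, which exists since \<open>r > 0\<close>.\<close>
    define \<eta> where "\<eta> = (\<lambda>(k::nat) (i::nat) y v. (if i = 0 then F y else 1) * \<Phi> y v)"
    have "smooth_canonical_form J' W (\<eta> k i)" for k i
    proof -
      have "smooth_on W (\<lambda>y. \<Phi> y v)" for v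
        using smooth_\<Phi> smooth_on_subset by blast
      then have "smooth_on W (\<lambda>y. (if i = 0 then F y else 1) * \<Phi> y v)" for v
        using F W by (cases "i = 0") (auto intro: smooth_on_mult)
      moreover have "(\<lambda>v. a * \<Phi> y v) \<in> canonical_fibre (J y)" for a y
      proof -
        have "linear (\<lambda>v. a * \<theta> y k v)" if "k < d" for k
          using linear_compose[OF linear_\<theta>[OF that] linear_times[of a]] by (simp add: o_def)
        then have "det_form d ((\<theta> y)(0 := (\<lambda>v. a * \<theta> y 0 v))) \<in> forms_of_type d 0 (J y)"
          by (intro det_form_in_forms_of_type) (auto simp: linear_\<theta> \<theta>_J)
        \<comment> \<open>The scalar \<open>a\<close> is absorbed into column 0. A nonzero basis
          vector and \<open>\<theta>_inj\<close> show that there is such a column.\<close>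
        moreover have "0 < d"
          using \<theta>_inj[of y "SOME b. b \<in> Basis"] nonzero_Basis[OF SOME_Basis] by (cases d) auto
        then have "det_form d ((\<theta> y)(0 := (\<lambda>v. a * \<theta> y 0 v))) = (\<lambda>v. a * \<Phi> y v)"
          using det_form_column_add[of 0 d "\<theta> y" a "\<theta> y 0" 0 "\<theta> y 0"]
          by (simp add: fun_eq_iff \<Phi>_def fun_upd_idem)
        ultimately show ?thesis
          by (simp add: canonical_fibre_def d)
      qed
      ultimately show ?thesis
        using J' by (simp add: smooth_canonical_form_def \<eta>_def)
    qed
    moreover have "s y = (\<lambda>v. \<Sum>k<1. pure_tensor r (\<lambda>i. \<eta> k i y) v)" if "y \<in> W" for y
    proof -
      have "{..<r} \<inter> {i. i = 0} = {0}"
        using r by auto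
      then show ?thesis
        using r s[OF that] by (simp add: pure_tensor_def \<eta>_def prod.distrib prod.If_cases)
    qed
    ultimately have "\<exists>t. ?P t W 1 \<eta>"
      using W by auto
    then obtain t where t: "?P t W 1 \<eta>" ..
    then show ?thesis
      unfolding unique[OF t] by (intro exI)
  qed
  show "t = ?t" if "\<exists>U N \<eta>. ?P t U N \<eta>" for t
    using that by (elim exE) (rule unique)
qed

end

section \<open>The invariant frame of the solvmanifold\<close>

definition a_exp ::
  "real \<Rightarrow> ('n::finite, 'm::finite) total_space \<Rightarrow> complex" where
  "a_exp lam x = exp (of_real lam * a_form (fst x))"

lemma a_exp_nonzero [simp]: "a_exp lam x \<noteq> 0"
  by (simp add: a_exp_def)

lemma linear_a_form: "linear (a_form :: complex ^ ('n::finite \<times> bool) \<Rightarrow> complex)"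
  by (rule linearI)
    (simp_all add: a_form_def sum.distrib[symmetric] sum_distrib_left algebra_simps
      scaleR_conv_of_real[where 'a = complex])

lemma linear_exponents:
  "linear (\<lambda>h. of_real r * a_form (fst h))" "linear (\<lambda>h. of_real r * cnj (a_form (fst h)))"
  by (auto intro!: linearI simp: linear_add[OF linear_a_form] linear_scale[OF linear_a_form] algebra_simps scaleR_conv_of_real[where 'a = complex])

lemma alpha_beta_Inl: "alpha_beta lam (Inl i) x v = fst v $ i"
  by (cases x; cases v) (simp add: alpha_beta_def phi_def)

lemma alpha_beta_Inr:
  "alpha_beta lam (Inr (j, False)) x v =
     of_real (sqrt 2 / 2) * (snd v $ (j, False) / a_exp lam x + \<i> * (cnj (a_exp lam x) * snd v $ (j, True)))"
  "alpha_beta lam (Inr (j, True)) x v =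
     of_real (sqrt 2 / 2) * (cnj (snd v $ (j, False)) / cnj (a_exp lam x) + \<i> * (a_exp lam x * cnj (snd v $ (j, True))))"
  by (cases x; cases v; simp add: alpha_beta_def psi_def a_exp_def exp_cnj exp_minus field_simps)+

lemmas alpha_beta_simps = alpha_beta_Inl alpha_beta_Inr

lemma frame_index_cases:
  fixes l :: "('n \<times> bool) + ('m \<times> bool)"
  obtains i where "l = Inl i" | j where "l = Inr (j, False)" | j where "l = Inr (j, True)"
proof (cases l)
  case (Inr p)
  obtain j b where "p = (j, b)" by (cases p)
  with Inr that show thesis by (cases b) auto
qed (use that in blast)

text \<open>The solution of the equations saying that all \<open>alpha_beta\<close> are of type
  (1,0). On the fibres it depends on the point only through the squared modulus of
  \<open>a_exp\<close>, which is e^(2 lam Re a).\<close>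

definition J_frame ::
  "real \<Rightarrow> ('n::finite, 'm::finite) total_space \<Rightarrow> ('n, 'm) total_space \<Rightarrow> ('n, 'm) total_space" where
  "J_frame lam x v = (\<chi> i. \<i> * fst v $ i,
     \<chi> l. case l of (j, b) \<Rightarrow> if b then snd v $ (j, False) / (a_exp lam x * cnj (a_exp lam x))
       else - (a_exp lam x * cnj (a_exp lam x) * snd v $ (j, True)))"

lemma J_frame_components:
  "fst (J_frame lam x v) $ i = \<i> * fst v $ i"
  "snd (J_frame lam x v) $ (j, False) = - (a_exp lam x * cnj (a_exp lam x) * snd v $ (j, True))"
  "snd (J_frame lam x v) $ (j, True) = snd v $ (j, False) / (a_exp lam x * cnj (a_exp lam x))"
  by (simp_all add: J_frame_def)

lemma total_space_eqI:
  fixes v w :: "('n::finite, 'm::finite) total_space"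
  assumes "\<And>i. fst v $ i = fst w $ i" "\<And>j. snd v $ (j, False) = snd w $ (j, False)"
    and "\<And>j. snd v $ (j, True) = snd w $ (j, True)"
  shows "v = w"
proof (rule prod_eqI)
  have "snd v $ (j, b) = snd w $ (j, b)" for j b
    using assms(2,3) by (cases b) auto
  then show "snd v = snd w"
    by (auto simp: Finite_Cartesian_Product.vec_eq_iff)
qed (simp add: Finite_Cartesian_Product.vec_eq_iff assms(1))

text \<open>For each fibre pair, the terms \<open>snd v $ (j, False) / a_exp lam x\<close> and
  \<open>\<i> * (cnj (a_exp lam x) * snd v $ (j, True))\<close> are determined by their sum and
  difference; solving for coframe values 1 and 0 gives these entries.\<close>

definition dual_frame ::
  "real \<Rightarrow> ('n \<times> bool) + ('m \<times> bool) \<Rightarrow> ('n::finite, 'm::finite) total_space \<Rightarrow> ('n, 'm) total_space" where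
  "dual_frame lam l x =
     (case l of
        Inl i \<Rightarrow> (axis i 1, 0)
      | Inr (j, s) \<Rightarrow> (0, axis (j, False) (a_exp lam x / of_real (sqrt 2)) +
          axis (j, True) ((if s then \<i> else - \<i>) / (of_real (sqrt 2) * cnj (a_exp lam x)))))"

text \<open>This form, \<open>torsion_factor\<close> and \<open>torsion_form\<close> are the c,
  \<tau> and \<zeta> of \<open>unimodular_frame\<close>. The torsion partner of one member of a
  \<beta>-pair is the conjugate of the other member.\<close>

definition connection_form ::
  "real \<Rightarrow> ('n \<times> bool) + ('m \<times> bool) \<Rightarrow> ('n::finite, 'm::finite) total_space \<Rightarrow> complex" where
  "connection_form lam l h =
     (case l of
        Inl i \<Rightarrow> 0
      | Inr (j, s) \<Rightarrow> of_real (lam / 2) *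
          (if s then a_form (fst h) - cnj (a_form (fst h)) else cnj (a_form (fst h)) - a_form (fst h)))"

definition torsion_factor ::
  "real \<Rightarrow> ('n::finite, 'm::finite) total_space \<Rightarrow> complex" where
  "torsion_factor lam h = - of_real (lam / 2) * (a_form (fst h) + cnj (a_form (fst h)))"

definition torsion_form ::
  "real \<Rightarrow> ('n \<times> bool) + ('m \<times> bool) \<Rightarrow> ('n::finite, 'm::finite) total_space \<Rightarrow> ('n, 'm) total_space \<Rightarrow> complex" where
  "torsion_form lam l x v =
     (case l of
        Inl i \<Rightarrow> 0
      | Inr (j, s) \<Rightarrow> cnj (alpha_beta lam (Inr (j, \<not> s)) x v))"

lemma linear_alpha_beta: "linear (alpha_beta lam l x)"
  by (cases l rule: frame_index_cases; rule linearI)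
    (simp_all add: alpha_beta_simps scaleR_conv_of_real[where 'a = complex] algebra_simps add_divide_distrib)

lemma linear_J_frame: "linear (J_frame lam x)"
  by (rule linearI; rule total_space_eqI)
    (simp_all add: J_frame_components scaleR_conv_of_real[where 'a = complex] algebra_simps add_divide_distrib)

lemma J_frame_J_frame: "J_frame lam x (J_frame lam x v) = - v"
  by (rule total_space_eqI) (simp_all add: J_frame_components mult.assoc[symmetric])

lemma alpha_beta_J_frame: "alpha_beta lam l x (J_frame lam x v) = \<i> * alpha_beta lam l x v"
  by (cases l rule: frame_index_cases) (auto simp: alpha_beta_simps J_frame_components field_simps)

lemma alpha_beta_dual_frame:
  "alpha_beta lam l x (dual_frame lam l' x) = (if l = l' then 1 else 0)"
proof -
  have 2: "complex_of_real (sqrt 2) * complex_of_real (sqrt 2) = 2"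
    by (simp flip: of_real_mult)
  show ?thesis
    by (cases l rule: frame_index_cases; cases l' rule: frame_index_cases)
      (auto simp: alpha_beta_simps dual_frame_def axis_def field_simps 2)
qed

lemma alpha_beta_inj:
  fixes v :: "('n::finite, 'm::finite) total_space"
  assumes "\<And>l. alpha_beta lam l x v = 0"
  shows "v = 0"
proof -
  let ?p = "a_exp lam x"
  have "fst v $ i = 0" for i
    using assms[of "Inl i"] by (simp add: alpha_beta_simps)
  moreover have "snd v $ (j, False) = 0 \<and> snd v $ (j, True) = 0" for j
  proof -
    have "snd v $ (j, False) / ?p + \<i> * (cnj ?p * snd v $ (j, True)) = 0"
      using assms[of "Inr (j, False)"] by (simp add: alpha_beta_simps)
    \<comment> \<open>Conjugating the second equation gives the difference of the two terms whose
      sum vanishes by the first.\<close>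
    moreover have "cnj (snd v $ (j, False) / ?p - \<i> * (cnj ?p * snd v $ (j, True))) = 0"
      using assms[of "Inr (j, True)"] by (simp add: alpha_beta_simps)
    then have "snd v $ (j, False) / ?p - \<i> * (cnj ?p * snd v $ (j, True)) = 0"
      using complex_cnj_zero_iff by blast
    ultimately have "snd v $ (j, False) / ?p = 0" "\<i> * (cnj ?p * snd v $ (j, True)) = 0"
      by (simp_all add: eq_iff_diff_eq_0[symmetric] add_eq_0_iff2)
    then show ?thesis
      by simp
  qed
  ultimately show ?thesis
    by (intro total_space_eqI) auto
qed

section \<open>The structure equations\<close>

lemma exp_linear_derivative:
  fixes L :: "'a::euclidean_space \<Rightarrow> complex"
  assumes "linear L"
  shows "((\<lambda>y. exp (L y)) has_derivative (\<lambda>h. exp (L x) * L h)) (at x)"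
  using has_derivative_compose[OF linear_imp_has_derivative[OF assms] DERIV_exp[unfolded has_field_derivative_def]]
  by blast

lemma alpha_beta_exp:
  "alpha_beta lam (Inr (j, False)) x v =
     of_real (sqrt 2 / 2) * snd v $ (j, False) * exp (of_real (- lam) * a_form (fst x)) +
     of_real (sqrt 2 / 2) * \<i> * snd v $ (j, True) * exp (of_real lam * cnj (a_form (fst x)))"
  "alpha_beta lam (Inr (j, True)) x v =
     of_real (sqrt 2 / 2) * cnj (snd v $ (j, False)) * exp (of_real (- lam) * cnj (a_form (fst x))) +
     of_real (sqrt 2 / 2) * \<i> * cnj (snd v $ (j, True)) * exp (of_real lam * a_form (fst x))"
  by (simp_all add: alpha_beta_simps a_exp_def exp_cnj exp_minus field_simps)

lemma smooth_alpha_beta: "smooth_on UNIV (\<lambda>x. alpha_beta lam l x v)"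
  by (cases l rule: frame_index_cases)
    (simp_all only: alpha_beta_Inl alpha_beta_exp smooth_on_add smooth_on_mult smooth_on_const
      smooth_on_exp_linear linear_exponents open_UNIV)

lemma alpha_beta_derivative:
  "((\<lambda>y. alpha_beta lam l y v) has_derivative
    (\<lambda>h. connection_form lam l h * alpha_beta lam l x v + torsion_factor lam h * torsion_form lam l x v)) (at x)"
proof (cases l rule: frame_index_cases)
  case (1 i)
  then show ?thesis by (simp add: alpha_beta_Inl connection_form_def torsion_form_def)
next
  case (2 j)
  have "((\<lambda>y. alpha_beta lam l y v) has_derivative (\<lambda>h.
      of_real (sqrt 2 / 2) * snd v $ (j, False) *
        (exp (of_real (- lam) * a_form (fst x)) * (of_real (- lam) * a_form (fst h))) +
      of_real (sqrt 2 / 2) * \<i> * snd v $ (j, True) *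
        (exp (of_real lam * cnj (a_form (fst x))) * (of_real lam * cnj (a_form (fst h)))))) (at x)"
    unfolding 2 alpha_beta_exp
    by (intro has_derivative_add has_derivative_mult_right exp_linear_derivative linear_exponents)
  then show ?thesis
    by (rule has_derivative_eq_rhs)
      (auto simp: fun_eq_iff 2 connection_form_def torsion_factor_def torsion_form_def alpha_beta_exp
        exp_cnj field_simps)
next
  case (3 j)
  have "((\<lambda>y. alpha_beta lam l y v) has_derivative (\<lambda>h.
      of_real (sqrt 2 / 2) * cnj (snd v $ (j, False)) *
        (exp (of_real (- lam) * cnj (a_form (fst x))) * (of_real (- lam) * cnj (a_form (fst h)))) +
      of_real (sqrt 2 / 2) * \<i> * cnj (snd v $ (j, True)) *
        (exp (of_real lam * a_form (fst x)) * (of_real lam * a_form (fst h))))) (at x)"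
    unfolding 3 alpha_beta_exp
    by (intro has_derivative_add has_derivative_mult_right exp_linear_derivative linear_exponents)
  then show ?thesis
    by (rule has_derivative_eq_rhs)
      (auto simp: fun_eq_iff 3 connection_form_def torsion_factor_def torsion_form_def alpha_beta_exp
        exp_cnj field_simps)
qed

lemma sum_UNIV_sum:
  fixes f :: "'a::finite + 'b::finite \<Rightarrow> 'c::comm_monoid_add"
  shows "(\<Sum>l\<in>UNIV. f l) = (\<Sum>i\<in>UNIV. f (Inl i)) + (\<Sum>j\<in>UNIV. f (Inr j))"
  unfolding UNIV_Plus_UNIV[symmetric] by (subst sum.Plus) auto

lemma sum_UNIV_pair:
  fixes f :: "'a::finite \<times> bool \<Rightarrow> 'c::comm_monoid_add"
  shows "(\<Sum>l\<in>UNIV. f l) = (\<Sum>i\<in>UNIV. f (i, False) + f (i, True))"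
proof -
  have "(\<Sum>l\<in>UNIV. f l) = (\<Sum>i\<in>UNIV. \<Sum>b\<in>UNIV. f (i, b))"
    using sum.cartesian_product[of "\<lambda>i b. f (i, b)" UNIV UNIV] by simp
  then show ?thesis
    by (simp add: UNIV_bool add.commute)
qed

lemma sum_connection_form: "(\<Sum>l\<in>UNIV. connection_form lam l h) = 0"
proof -
  have "connection_form lam (Inr (j, False)) h + connection_form lam (Inr (j, True)) h = 0" for j
    by (simp add: connection_form_def field_simps)
  then show ?thesis
    unfolding sum_UNIV_sum sum_UNIV_pair by (simp add: connection_form_def)
qed

lemma linear_torsion_factor: "linear (torsion_factor lam)"
  by (auto intro!: linearI simp: linear_add[OF linear_a_form] linear_scale[OF linear_a_form] torsion_factor_def algebra_simps add_divide_distrib scaleR_conv_of_real[where 'a = complex])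

text \<open>The base carries its standard complex structure, so the (1,0)-part of da plus its
  conjugate is the sum of all dw_i, whichever coordinates enter \<open>a_form\<close>
  conjugated.\<close>

lemma torsion_factor_10:
  "clin (torsion_factor lam) (vec10 (J_frame lam x) v) =
    (\<Sum>l\<in>UNIV. (case l of Inl i \<Rightarrow> - of_real (lam / 2) | Inr j \<Rightarrow> 0) * alpha_beta lam l x v)"
proof -
  have tf: "torsion_factor lam h = - of_real (lam / 2) * (\<Sum>i\<in>UNIV. fst h $ i + cnj (fst h $ i))" for h
    unfolding torsion_factor_def a_form_def sum_UNIV_pair by (simp add: sum.distrib[symmetric] algebra_simps)
  let ?z = "vec10 (J_frame lam x) v"
  have "fst (fst ?z) $ i + cnj (fst (fst ?z) $ i) + \<i> * (fst (snd ?z) $ i + cnj (fst (snd ?z) $ i)) = fst v $ i" for i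
    by (simp add: vec10_def J_frame_components scaleR_conv_of_real[where 'a = complex] field_simps)
  then have "(\<Sum>i\<in>UNIV. fst v $ i) = (\<Sum>i\<in>UNIV. fst (fst ?z) $ i + cnj (fst (fst ?z) $ i)) +
      \<i> * (\<Sum>i\<in>UNIV. fst (snd ?z) $ i + cnj (fst (snd ?z) $ i))"
    unfolding sum_distrib_left sum.distrib[symmetric] by (intro sum.cong refl) simp
  then have "clin (torsion_factor lam) ?z = - of_real (lam / 2) * (\<Sum>i\<in>UNIV. fst v $ i)"
    unfolding clin_def tf by (simp only: ring_distribs mult.left_commute)
  then show ?thesis
    by (simp add: sum_UNIV_sum alpha_beta_Inl sum_distrib_left sum_negf)
qed

section \<open>The lattice and the charts of the solvmanifold\<close>

lemma diag_matrix_mult: "(diag_matrix f *v z) $ i = f i * (z $ i :: 'a::comm_semiring_1)"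
  by (simp add: matrix_vector_mult_def diag_matrix_def if_distrib if_distribR cong: if_cong)

lemma rho_mult:
  "(rho lam w *v z) $ (j, False) = exp (of_real lam * a_form w) * z $ (j, False)"
  "(rho lam w *v z) $ (j, True) = inverse (cnj (exp (of_real lam * a_form w))) * z $ (j, True)"
  by (simp_all add: rho_def diag_matrix_mult exp_cnj exp_minus)

lemma det_real_matrix: "Determinants.det (real_matrix A) = of_int (Determinants.det A)"
  by (simp add: Determinants.det_def real_matrix_def)

lemma fst_semidirect_mult: "fst (semidirect_mult lam g x) = fst g + fst x"
  and snd_semidirect_mult: "snd (semidirect_mult lam g x) = rho lam (fst g) *v snd x + snd g"
  by (simp_all add: semidirect_mult_def case_prod_beta)

lemma a_form_add: "a_form (v + w) = a_form v + a_form w"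
  using linear_add[OF linear_a_form] .

lemma a_form_0 [simp]: "a_form 0 = 0"
  using linear_0[OF linear_a_form] .

lemma semidirect_mult_assoc:
  "semidirect_mult lam (semidirect_mult lam g h) x = semidirect_mult lam g (semidirect_mult lam h x)"
  by (rule total_space_eqI)
    (simp_all add: fst_semidirect_mult snd_semidirect_mult rho_mult a_form_add exp_add algebra_simps)

definition translation_deriv ::
  "real \<Rightarrow> ('n::finite, 'm::finite) total_space \<Rightarrow> ('n, 'm) total_space \<Rightarrow> ('n, 'm) total_space" where
  "translation_deriv lam g v = (fst v, rho lam (fst g) *v snd v)"

lemma semidirect_mult_derivative:
  "(semidirect_mult lam g has_derivative translation_deriv lam g) (at x)"
proof -
  have "linear (translation_deriv lam g)"
    by (rule linearI; rule total_space_eqI)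
      (simp_all add: translation_deriv_def rho_mult algebra_simps scaleR_conv_of_real[where 'a = complex])
  then have "((\<lambda>x. translation_deriv lam g x + g) has_derivative translation_deriv lam g) (at x)"
    by (intro has_derivative_add_const linear_imp_has_derivative)
  moreover have "semidirect_mult lam g = (\<lambda>x. translation_deriv lam g x + g)"
    by (auto simp: fun_eq_iff prod_eq_iff fst_semidirect_mult snd_semidirect_mult translation_deriv_def)
  ultimately show ?thesis by simp
qed

text \<open>Left invariance: the factor by which \<open>rho\<close> scales a fibre coordinate
  cancels against the change of the exponential under the shift of the base point.\<close>

lemma alpha_beta_translation:
  "alpha_beta lam l (semidirect_mult lam g x) (translation_deriv lam g v) = alpha_beta lam l x v"
  by (cases l rule: frame_index_cases)
    (simp_all add: alpha_beta_simps translation_deriv_def rho_mult a_exp_def fst_semidirect_mult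
      a_form_add exp_add distrib_left field_simps)

locale solvmanifold_data =
  fixes M :: "int ^ ('m::finite \<times> bool) ^ ('m \<times> bool)"
    and P :: "real ^ ('m \<times> bool) ^ ('m \<times> bool)"
    and lam :: real
    and k :: "'n::finite \<times> bool \<Rightarrow> int"
  assumes det_M: "Determinants.det M = 1"
    and invertible_P: "invertible P"
    and lam: "lam \<noteq> 0"
    and conjugation: "P ** real_matrix M ** matrix_inv P =
           diag_matrix (\<lambda>(j, b). if b then exp (- lam) else exp lam)"
    and k: "\<And>i. k i \<noteq> 0"
begin

abbreviation "\<Gamma> \<equiv> Defs.lattice lam k P"
abbreviation "act \<equiv> semidirect_mult lam :: ('n, 'm) total_space \<Rightarrow> _"
abbreviation "cs \<equiv> coset lam k P"

section \<open>The base lattice preserves the fibre lattice\<close>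

lemma matrix_inv_P: "P ** matrix_inv P = mat 1" "matrix_inv P ** P = mat 1"
  using someI_ex[OF invertible_P[unfolded invertible_def]] by (simp_all add: matrix_inv_def)

text \<open>The lattice P Z^(2m). Lattice elements act on fibres by real matrices, so real and
  imaginary parts can be treated separately.\<close>

definition real_fibre :: "(real ^ ('m \<times> bool)) set" where
  "real_fibre = range (\<lambda>p :: 'm \<times> bool \<Rightarrow> int. P *v (\<chi> j. of_int (p j)))"

lemma real_fibreI: "P *v (\<chi> j. of_int (p j)) \<in> real_fibre"
  by (simp add: real_fibre_def)

lemma lattice_fibre_iff:
  "z \<in> lattice_fibre P \<longleftrightarrow> (\<chi> i. Re (z $ i)) \<in> real_fibre \<and> (\<chi> i. Im (z $ i)) \<in> real_fibre"
proof
  assume "z \<in> lattice_fibre P"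
  then obtain p q :: "'m \<times> bool \<Rightarrow> int" where
    "\<And>i. z $ i = of_real ((P *v (\<chi> j. of_int (p j))) $ i) + \<i> * of_real ((P *v (\<chi> j. of_int (q j))) $ i)"
    unfolding lattice_fibre_def by blast
  then have "(\<chi> i. Re (z $ i)) = P *v (\<chi> j. of_int (p j))" "(\<chi> i. Im (z $ i)) = P *v (\<chi> j. of_int (q j))"
    by (simp_all add: Finite_Cartesian_Product.vec_eq_iff)
  then show "(\<chi> i. Re (z $ i)) \<in> real_fibre \<and> (\<chi> i. Im (z $ i)) \<in> real_fibre"
    by (auto simp: real_fibre_def)
next
  assume "(\<chi> i. Re (z $ i)) \<in> real_fibre \<and> (\<chi> i. Im (z $ i)) \<in> real_fibre"
  then obtain p q :: "'m \<times> bool \<Rightarrow> int" where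
    "(\<chi> i. Re (z $ i)) = P *v (\<chi> j. of_int (p j))" "(\<chi> i. Im (z $ i)) = P *v (\<chi> j. of_int (q j))"
    by (auto simp: real_fibre_def)
  then have "z $ i = of_real ((P *v (\<chi> j. of_int (p j))) $ i) + \<i> * of_real ((P *v (\<chi> j. of_int (q j))) $ i)" for i
    by (metis complex_eq vec_lambda_beta)
  then show "z \<in> lattice_fibre P"
    unfolding lattice_fibre_def by blast
qed

lemma real_fibre_0: "0 \<in> real_fibre"
proof -
  have "P *v (\<chi> j. of_int 0) = 0"
    by (simp add: Finite_Cartesian_Product.vec_eq_iff matrix_vector_mult_def)
  then show ?thesis using real_fibreI[of "\<lambda>_. 0"] by simp
qed

lemma real_fibre_diff:
  assumes "x \<in> real_fibre" "y \<in> real_fibre"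
  shows "x - y \<in> real_fibre"
proof -
  obtain p q :: "'m \<times> bool \<Rightarrow> int" where
    pq: "x = P *v (\<chi> j. of_int (p j))" "y = P *v (\<chi> j. of_int (q j))"
    using assms by (auto simp: real_fibre_def)
  have "(\<chi> j. real_of_int (p j)) - (\<chi> j. of_int (q j)) = (\<chi> j. of_int (p j - q j))"
    by (simp add: Finite_Cartesian_Product.vec_eq_iff)
  then have "x - y = P *v (\<chi> j. of_int (p j - q j))"
    unfolding pq by (simp only: matrix_vector_mult_diff_distrib[symmetric])
  then show ?thesis by (simp only: real_fibreI)
qed

lemma lattice_fibre_0: "0 \<in> lattice_fibre P"
  using real_fibre_0 by (simp add: lattice_fibre_iff Finite_Cartesian_Product.zero_vec_def)

lemma lattice_fibre_diff:
  assumes "x \<in> lattice_fibre P" "y \<in> lattice_fibre P"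
  shows "x - y \<in> lattice_fibre P"
proof -
  have "(\<chi> i. Re ((x - y) $ i)) = (\<chi> i. Re (x $ i)) - (\<chi> i. Re (y $ i))"
    "(\<chi> i. Im ((x - y) $ i)) = (\<chi> i. Im (x $ i)) - (\<chi> i. Im (y $ i))"
    by (simp_all add: Finite_Cartesian_Product.vec_eq_iff)
  then show ?thesis
    using assms by (simp add: lattice_fibre_iff real_fibre_diff)
qed

text \<open>The matrix P M^a P^(-1) in its diagonal form, which makes sense for negative
  \<open>a\<close> without inverting M.\<close>

definition expand ::
  "int \<Rightarrow> real ^ ('m \<times> bool) \<Rightarrow> real ^ ('m \<times> bool)" where
  "expand a x = (\<chi> l. exp ((if snd l then - lam else lam) * of_int a) * x $ l)"

lemma expand_add: "expand (a + b) x = expand a (expand b x)"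
  by (simp add: expand_def Finite_Cartesian_Product.vec_eq_iff distrib_left exp_add)

lemma expand_0: "expand 0 x = x"
  by (simp add: expand_def Finite_Cartesian_Product.vec_eq_iff)

lemma expand_1: "expand 1 (P *v v) = P *v (real_matrix M *v v)"
proof -
  have "expand 1 x = P ** real_matrix M ** matrix_inv P *v x" for x
    unfolding conjugation by (auto simp: expand_def Finite_Cartesian_Product.vec_eq_iff diag_matrix_mult)
  then have "expand 1 (P *v v) = (P ** real_matrix M ** (matrix_inv P ** P)) *v v"
    by (simp add: matrix_vector_mul_assoc matrix_mul_assoc)
  then show ?thesis
    using matrix_inv_P(2) by (simp add: matrix_vector_mul_assoc)
qed

lemma real_matrix_of_int: "real_matrix A *v (\<chi> j. of_int (p j)) = (\<chi> i. of_int (\<Sum>j\<in>UNIV. A $ i $ j * p j))"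
  by (simp add: matrix_vector_mult_def real_matrix_def Finite_Cartesian_Product.vec_eq_iff)

text \<open>As M has determinant 1, the denominators in Cramer's rule are 1 and the numerators are
  determinants of integer matrices.\<close>

lemma integer_solution: "\<exists>q. real_matrix M *v (\<chi> j. of_int (q j)) = (\<chi> j. of_int (p j :: int))"
proof -
  define q where "q l = Determinants.det (\<chi> i j. if j = l then p i else M $ i $ j)" for l
  have "real_of_int (q l) = Determinants.det (\<chi> i j. if j = l then (\<chi> j. of_int (p j)) $ i else real_matrix M $ i $ j)" for l
    unfolding q_def det_real_matrix[symmetric]
    by (rule arg_cong[of _ _ Determinants.det]) (auto simp: real_matrix_def Finite_Cartesian_Product.vec_eq_iff)
  then have "(\<chi> l. of_int (q l)) = (\<chi> l. Determinants.det
      (\<chi> i j. if j = l then (\<chi> j. of_int (p j)) $ i else real_matrix M $ i $ j) / Determinants.det (real_matrix M))"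
    by (simp add: det_real_matrix det_M)
  then have "real_matrix M *v (\<chi> j. of_int (q j)) = (\<chi> j. of_int (p j :: int))"
    by (subst cramer) (simp_all add: det_real_matrix det_M)
  then show ?thesis by blast
qed

lemma expand_real_fibre: "x \<in> real_fibre \<Longrightarrow> expand a x \<in> real_fibre"
proof (induction a rule: int_induct[of _ 0])
  case base
  then show ?case by (simp add: expand_0)
next
  case (step1 a)
  then obtain p :: "'m \<times> bool \<Rightarrow> int" where "expand a x = P *v (\<chi> j. of_int (p j))"
    by (auto simp: real_fibre_def)
  then have "expand (a + 1) x = P *v (\<chi> i. of_int (\<Sum>j\<in>UNIV. M $ i $ j * p j))"
    by (simp only: add.commute[of a] expand_add expand_1 real_matrix_of_int)
  then show ?case by (simp only: real_fibreI)
next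
  case (step2 a)
  then obtain p :: "'m \<times> bool \<Rightarrow> int" where p: "expand a x = P *v (\<chi> j. of_int (p j))"
    by (auto simp: real_fibre_def)
  obtain q :: "'m \<times> bool \<Rightarrow> int" where "real_matrix M *v (\<chi> j. of_int (q j)) = (\<chi> j. of_int (p j))"
    using integer_solution by blast
  then have "expand a x = expand 1 (P *v (\<chi> j. of_int (q j)))"
    by (simp add: p expand_1)
  then have "expand (- 1 + a) x = expand (- 1 + 1) (P *v (\<chi> j. of_int (q j)))"
    by (simp only: expand_add)
  then have "expand (a - 1) x = P *v (\<chi> j. of_int (q j))"
    by (simp add: expand_0)
  then show ?case by (simp only: real_fibreI)
qed

text \<open>The factors \<open>2 k\<^sub>i \<pi> / \<lambda>\<close> are chosen such that the imaginary lattice directions act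
  trivially on the fibres.\<close>

lemma exp_lattice_base:
  assumes "w \<in> lattice_base lam k"
  obtains a :: int where "exp (of_real lam * a_form w) = of_real (exp (lam * of_int a))"
proof -
  obtain p q :: "'n \<times> bool \<Rightarrow> int" where
    w: "\<And>i. w $ i = of_int (p i) + \<i> * of_real (2 * of_int (k i) * pi / lam) * of_int (q i)"
    using assms unfolding lattice_base_def by blast
  define a where "a = (\<Sum>i\<in>UNIV. p (i, False) + p (i, True))"
  \<comment> \<open>The minus sign comes from the conjugation of the second coordinate of each pair
    in \<open>a_form\<close>.\<close>
  define b where "b = (\<Sum>i\<in>UNIV. k (i, False) * q (i, False) - k (i, True) * q (i, True))"
  have "of_real lam * (w $ (i, False) + cnj (w $ (i, True))) =
      of_real lam * of_int (p (i, False) + p (i, True)) +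
      2 * of_real pi * \<i> * of_int (k (i, False) * q (i, False) - k (i, True) * q (i, True))" for i
    using lam by (simp add: w field_simps)
  then have "of_real lam * a_form w = of_real lam * of_int a + 2 * of_real pi * \<i> * of_int b"
    unfolding a_form_def a_def b_def of_int_sum sum_distrib_left sum.distrib[symmetric] by simp
  moreover have "exp (2 * of_real pi * \<i> * of_int b) = 1"
    using exp_integer_2pi[of "of_int b"] by (simp add: mult_ac)
  ultimately have "exp (of_real lam * a_form w) = of_real (exp (lam * of_int a))"
    by (simp add: exp_add exp_of_real[symmetric])
  then show thesis by (rule that)
qed

lemma rho_lattice_fibre:
  assumes w: "w \<in> lattice_base lam k" and z: "z \<in> lattice_fibre P"
  shows "rho lam w *v z \<in> lattice_fibre P"
proof -
  obtain a :: int where a: "exp (of_real lam * a_form w) = of_real (exp (lam * of_int a))"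
    using exp_lattice_base[OF w] .
  have "(rho lam w *v z) $ l = of_real (exp ((if snd l then - lam else lam) * of_int a)) * z $ l" for l
    by (cases l; cases "snd l") (simp_all add: rho_mult a exp_minus)
  then have "(\<chi> i. Re ((rho lam w *v z) $ i)) = expand a (\<chi> i. Re (z $ i))"
    "(\<chi> i. Im ((rho lam w *v z) $ i)) = expand a (\<chi> i. Im (z $ i))"
    by (simp_all add: expand_def Finite_Cartesian_Product.vec_eq_iff)
  then show ?thesis
    using z by (simp add: lattice_fibre_iff expand_real_fibre)
qed

lemma lattice_base_0: "0 \<in> lattice_base lam k"
  unfolding lattice_base_def by (auto intro!: exI[of _ "\<lambda>_. 0"])

lemma lattice_base_diff:
  assumes "v \<in> lattice_base lam k" "w \<in> lattice_base lam k"
  shows "v - w \<in> lattice_base lam k"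
proof -
  obtain p q p' q' :: "'n \<times> bool \<Rightarrow> int" where
    "\<And>i. v $ i = of_int (p i) + \<i> * of_real (2 * of_int (k i) * pi / lam) * of_int (q i)"
    "\<And>i. w $ i = of_int (p' i) + \<i> * of_real (2 * of_int (k i) * pi / lam) * of_int (q' i)"
    using assms unfolding lattice_base_def by blast
  then have "(v - w) $ i = of_int (p i - p' i) +
      \<i> * of_real (2 * of_int (k i) * pi / lam) * of_int (q i - q' i)" for i
    by (simp only: vector_minus_component of_int_diff right_diff_distrib) simp
  then show ?thesis
    unfolding lattice_base_def mem_Collect_eq
    by (intro exI[of _ "\<lambda>i. p i - p' i"] exI[of _ "\<lambda>i. q i - q' i"] allI)
qed

section \<open>The lattice as a subgroup, its cosets and the transition maps\<close>

lemma lattice_0: "0 \<in> \<Gamma>"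
  by (simp add: Defs.lattice_def zero_prod_def lattice_base_0 lattice_fibre_0)

lemma semidirect_mult_0: "act 0 x = x"
  by (rule total_space_eqI) (simp_all add: fst_semidirect_mult snd_semidirect_mult rho_mult)

lemma lattice_mult:
  assumes "g \<in> \<Gamma>" "h \<in> \<Gamma>"
  shows "act g h \<in> \<Gamma>"
proof -
  have "fst g - (0 - fst h) \<in> lattice_base lam k"
    using assms by (intro lattice_base_diff lattice_base_0) (auto simp: Defs.lattice_def)
  moreover have "rho lam (fst g) *v snd h - (0 - snd g) \<in> lattice_fibre P"
    using assms by (intro lattice_fibre_diff lattice_fibre_0 rho_lattice_fibre) (auto simp: Defs.lattice_def)
  ultimately show ?thesis
    by (simp add: Defs.lattice_def mem_Times_iff fst_semidirect_mult snd_semidirect_mult)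
qed

lemma lattice_inverse:
  assumes "g \<in> \<Gamma>"
  obtains h where "h \<in> \<Gamma>" "act h g = 0"
proof
  let ?h = "(0 - fst g, 0 - rho lam (0 - fst g) *v snd g)"
  have "0 - fst g \<in> lattice_base lam k"
    using assms by (intro lattice_base_diff lattice_base_0) (auto simp: Defs.lattice_def)
  moreover from this have "0 - rho lam (0 - fst g) *v snd g \<in> lattice_fibre P"
    using assms by (intro lattice_fibre_diff lattice_fibre_0 rho_lattice_fibre) (auto simp: Defs.lattice_def)
  ultimately show "?h \<in> \<Gamma>"
    by (simp add: Defs.lattice_def)
  show "act ?h g = 0"
    by (simp add: prod_eq_iff fst_semidirect_mult snd_semidirect_mult)
qed

lemma mem_coset: "y \<in> cs x \<longleftrightarrow> (\<exists>g\<in>\<Gamma>. y = act g x)"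
  by (auto simp: coset_def)

lemma coset_mult:
  assumes "g \<in> \<Gamma>"
  shows "cs (act g x) = cs x"
proof -
  obtain h where h: "h \<in> \<Gamma>" "act h g = 0"
    using lattice_inverse[OF assms] .
  have "act f (act g x) = act (act f g) x" for f
    by (simp add: semidirect_mult_assoc)
  moreover have "act f x = act (act f h) (act g x)" for f
    using h(2) semidirect_mult_0 by (metis semidirect_mult_assoc)
  ultimately show ?thesis
    using lattice_mult assms h(1) unfolding set_eq_iff mem_coset by metis
qed

lemma coset_eqD:
  assumes "cs x = cs y"
  obtains g where "g \<in> \<Gamma>" "y = act g x"
  using assms mem_coset[of y x] mem_coset[of y y] lattice_0 semidirect_mult_0 by metis

text \<open>Near \<open>x\<close> the translate by \<open>g\<close> stays in \<open>U'\<close>, and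
  injectivity of the quotient map there makes it the only point of \<open>U'\<close> in its coset.
  So the transition map is locally a left translation.\<close>

lemma solvmanifold_transition:
  assumes c: "(U, cs) \<in> solvmanifold lam k P" "(U', cs) \<in> solvmanifold lam k P"
    and x: "x \<in> U" and g: "g \<in> \<Gamma>" "act g x \<in> U'"
  shows "x \<in> overlap (U, cs) (U', cs)"
    and "transition (U, cs) (U', cs) x = act g x"
    and "frechet_derivative (transition (U, cs) (U', cs)) (at x) = translation_deriv lam g"
proof -
  have U: "open U" "open U'" "inj_on cs U'"
    using c by (auto simp: solvmanifold_def)
  have t: "transition (U, cs) (U', cs) y = act g y" if "act g y \<in> U'" for y
    using inv_into_f_f[OF U(3) that] coset_mult[OF g(1)] by (simp add: transition_def)
  show "x \<in> overlap (U, cs) (U', cs)"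
    using x g coset_mult[OF g(1), of x] by (auto simp: overlap_def intro!: image_eqI[of _ _ "act g x"])
  show "transition (U, cs) (U', cs) x = act g x"
    using t g(2) .
  have "continuous_on UNIV (act g)"
    by (intro continuous_at_imp_continuous_on ballI has_derivative_continuous[OF semidirect_mult_derivative])
  then have "open (act g -` U')"
    using U(2) by (simp add: open_vimage)
  then have "(transition (U, cs) (U', cs) has_derivative translation_deriv lam g) (at x)"
    using g(2) t by (intro has_derivative_transform_within_open[OF semidirect_mult_derivative]) auto
  then show "frechet_derivative (transition (U, cs) (U', cs)) (at x) = translation_deriv lam g"
    by (rule frechet_derivative_at[symmetric])
qed

lemma overlapD:
  assumes "x \<in> overlap (U, cs) (U', cs)"
  obtains g where "g \<in> \<Gamma>" "act g x \<in> U'"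
proof -
  obtain y where "y \<in> U'" "cs x = cs y"
    using assms by (auto simp: overlap_def)
  then show thesis
    using that coset_eqD by metis
qed

section \<open>Discreteness, charts and cocompactness\<close>

lemma lattice_base_discrete:
  obtains e where "e > 0" "\<And>w. w \<in> lattice_base lam k \<Longrightarrow> norm w < e \<Longrightarrow> w = 0"
proof
  \<comment> \<open>The real spacing is 1, and each imaginary spacing is a nonzero integer multiple
    of 2 pi / lam.\<close>
  let ?e = "min 1 (2 * pi / \<bar>lam\<bar>)"
  show "?e > 0"
    using lam by simp
  fix w :: "complex ^ ('n \<times> bool)"
  assume "w \<in> lattice_base lam k" and less: "norm w < ?e"
  then obtain p q :: "'n \<times> bool \<Rightarrow> int" where
    w: "\<And>i. w $ i = of_int (p i) + \<i> * of_real (2 * of_int (k i) * pi / lam) * of_int (q i)"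
    unfolding lattice_base_def by blast
  have "w $ i = 0" for i
  proof -
    have n: "cmod (w $ i) < ?e"
      using Finite_Cartesian_Product.norm_nth_le[of w i] less by linarith
    have "\<bar>Re (w $ i)\<bar> < 1"
      using n abs_Re_le_cmod[of "w $ i"] by linarith
    then have "\<bar>real_of_int (p i)\<bar> < 1"
      by (simp add: w)
    then have p: "p i = 0" by linarith
    have "\<bar>Im (w $ i)\<bar> < 2 * pi / \<bar>lam\<bar>"
      using n abs_Im_le_cmod[of "w $ i"] by linarith
    then have "2 * pi / \<bar>lam\<bar> * \<bar>real_of_int (k i * q i)\<bar> < 2 * pi / \<bar>lam\<bar> * 1"
      by (simp add: w abs_mult mult_ac)
    then have "\<bar>real_of_int (k i * q i)\<bar> < 1"
      using lam by (subst (asm) mult_less_cancel_left_pos) auto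
    then have "k i * q i = 0" by linarith
    then have "q i = 0"
      using k by simp
    with p show ?thesis by (simp add: w)
  qed
  then show "w = 0"
    by (simp add: Finite_Cartesian_Product.vec_eq_iff)
qed

lemma lattice_fibre_discrete:
  obtains e where "e > 0" "\<And>z. z \<in> lattice_fibre P \<Longrightarrow> norm z < e \<Longrightarrow> z = 0"
proof
  let ?Q = "matrix_inv P"
  \<comment> \<open>A bound for the row sums of the inverse of P: if the entries of x are smaller
    than 1/K, its integer coordinates are smaller than 1. The summand 1 keeps \<open>K\<close>
    positive.\<close>
  define K where "K = 1 + (\<Sum>j\<in>UNIV. \<Sum>i\<in>UNIV. \<bar>?Q $ j $ i\<bar>)"
  have K: "K > 0"
    unfolding K_def by (intro add_pos_nonneg sum_nonneg) auto
  then show "1 / K > 0" by simp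
  have zero: "x = 0" if x: "x \<in> real_fibre" and small: "\<And>i. \<bar>x $ i\<bar> \<le> r" "r < 1 / K" for x :: "real ^ ('m \<times> bool)" and r
  proof -
    obtain p :: "'m \<times> bool \<Rightarrow> int" where p: "x = P *v (\<chi> j. of_int (p j))"
      using x by (auto simp: real_fibre_def)
    then have "?Q *v x = (\<chi> j. of_int (p j))"
      using matrix_inv_P(2) by (simp add: matrix_vector_mul_assoc)
    then have "(?Q *v x) $ j = of_int (p j)" for j
      by simp
    then have pj: "of_int (p j) = (\<Sum>i\<in>UNIV. ?Q $ j $ i * x $ i)" for j
      by (simp add: matrix_vector_mult_def)
    have "p j = 0" for j
    proof -
      have r: "0 \<le> r"
        using small(1)[of j] by linarith
      have "\<bar>real_of_int (p j)\<bar> \<le> (\<Sum>i\<in>UNIV. \<bar>?Q $ j $ i\<bar> * r)"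
        unfolding pj using small(1) by (intro order.trans[OF sum_abs] sum_mono) (auto simp: abs_mult intro: mult_left_mono)
      also have "\<dots> = (\<Sum>i\<in>UNIV. \<bar>?Q $ j $ i\<bar>) * r"
        by (simp add: sum_distrib_right)
      also have "\<dots> \<le> K * r"
      proof (rule mult_right_mono[OF _ r])
        have "(\<Sum>i\<in>UNIV. \<bar>?Q $ j $ i\<bar>) \<le> (\<Sum>j\<in>UNIV. \<Sum>i\<in>UNIV. \<bar>?Q $ j $ i\<bar>)"
          by (rule member_le_sum) (auto intro: sum_nonneg)
        then show "(\<Sum>i\<in>UNIV. \<bar>?Q $ j $ i\<bar>) \<le> K" by (simp add: K_def)
      qed
      also have "\<dots> < 1"
        using small(2) K by (simp add: field_simps)
      finally show "p j = 0" by linarith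
    qed
    then show "x = 0"
      by (simp add: p Finite_Cartesian_Product.vec_eq_iff matrix_vector_mult_def)
  qed
  fix z :: "complex ^ ('m \<times> bool)"
  assume z: "z \<in> lattice_fibre P" "norm z < 1 / K"
  have "\<bar>Re (z $ i)\<bar> \<le> norm z \<and> \<bar>Im (z $ i)\<bar> \<le> norm z" for i
    using Finite_Cartesian_Product.norm_nth_le[of z i] abs_Re_le_cmod[of "z $ i"] abs_Im_le_cmod[of "z $ i"] by linarith
  then have "(\<chi> i. Re (z $ i)) = 0" "(\<chi> i. Im (z $ i)) = 0"
    using z by (auto simp: lattice_fibre_iff intro!: zero[of _ "norm z"])
  then show "z = 0"
    by (simp add: Finite_Cartesian_Product.vec_eq_iff complex_eq_iff)
qed

lemma chart_around:
  obtains U where "(U, cs) \<in> solvmanifold lam k P" "x \<in> U"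
proof -
  obtain e where e: "e > 0" "\<And>w. w \<in> lattice_base lam k \<Longrightarrow> norm w < e \<Longrightarrow> w = 0"
    by (rule lattice_base_discrete) blast
  obtain e' where e': "e' > 0" "\<And>z. z \<in> lattice_fibre P \<Longrightarrow> norm z < e' \<Longrightarrow> z = 0"
    by (rule lattice_fibre_discrete) blast
  \<comment> \<open>Half the radius, so that any two points of the ball are closer than both
    \<open>e\<close> and \<open>e'\<close>.\<close>
  let ?U = "ball x (min e e' / 2)"
  have "inj_on cs ?U"
  proof (rule inj_onI)
    fix y y'
    assume U: "y \<in> ?U" "y' \<in> ?U" and eq: "cs y = cs y'"
    obtain g where g: "g \<in> \<Gamma>" "y' = act g y"
      using coset_eqD[OF eq] .
    have "norm (y' - y) < min e e'"
      using U dist_triangle_half_r[of x y' "min e e'" y] by (simp add: dist_norm)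
    then have small: "norm (fst y' - fst y) < e" "norm (snd y' - snd y) < e'"
      using norm_fst_le[of "fst y' - fst y" "snd y' - snd y"] norm_snd_le[of "snd y' - snd y" "fst y' - fst y"]
      unfolding minus_prod_def[symmetric] by linarith+
    have "fst y' - fst y = fst g"
      by (simp add: g(2) fst_semidirect_mult)
    then have w: "fst g = 0"
      using g(1) e(2)[of "fst g"] small by (auto simp: Defs.lattice_def)
    \<comment> \<open>With trivial base part, \<open>g\<close> no longer twists the fibre, and the
      fibre coordinates differ just by \<open>snd g\<close>.\<close>
    have "snd (act 0 y) = snd y"
      by (simp only: semidirect_mult_0)
    then have "rho lam (fst g) *v snd y = snd y"
      by (simp add: snd_semidirect_mult w)
    then have "snd y' - snd y = snd g"
      by (simp add: g(2) snd_semidirect_mult)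
    then have "snd g = 0"
      using g(1) e'(2)[of "snd g"] small by (auto simp: Defs.lattice_def)
    with w have "g = 0"
      by (simp add: prod_eq_iff)
    then show "y = y'"
      by (simp add: g(2) semidirect_mult_0)
  qed
  then show thesis
    using e(1) e'(1) by (intro that[of ?U]) (auto simp: solvmanifold_def)
qed

lemma norm_vec_le_sum: "norm (v :: 'a::real_normed_vector ^ 'i::finite) \<le> (\<Sum>i\<in>UNIV. norm (v $ i))"
  unfolding norm_vec_def by (rule L2_set_le_sum) simp

text \<open>Compactness of the quotient in the form that bounds invariant functions: every orbit
  meets a fixed ball. Floors reduce the coordinates modulo the lattice, those of the fibre with
  respect to the basis given by P.\<close>

lemma cocompact: "\<exists>R. \<forall>x :: ('n, 'm) total_space. \<exists>g\<in>\<Gamma>. norm (act g x) \<le> R"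
proof -
  define \<mu> where "\<mu> i = 2 * of_int (k i) * pi / lam" for i
  have \<mu>: "\<mu> i \<noteq> 0" for i
    using k lam by (simp add: \<mu>_def)
  have base: "\<exists>v\<in>lattice_base lam k. \<forall>i. cmod ((v + w) $ i) \<le> 1 + \<bar>\<mu> i\<bar>" for w
  proof
    let ?v = "\<chi> i. of_int (- \<lfloor>Re (w $ i)\<rfloor>) + \<i> * of_real (\<mu> i) * of_int (- \<lfloor>Im (w $ i) / \<mu> i\<rfloor>)"
    show "?v \<in> lattice_base lam k"
      unfolding lattice_base_def mem_Collect_eq
      by (intro exI[of _ "\<lambda>i. - \<lfloor>Re (w $ i)\<rfloor>"] exI[of _ "\<lambda>i. - \<lfloor>Im (w $ i) / \<mu> i\<rfloor>"])
        (simp add: \<mu>_def)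
    show "\<forall>i. cmod ((?v + w) $ i) \<le> 1 + \<bar>\<mu> i\<bar>"
    proof
      fix i
      have "Re ((?v + w) $ i) = frac (Re (w $ i))"
        by (simp add: frac_def)
      moreover have "Im ((?v + w) $ i) = \<mu> i * frac (Im (w $ i) / \<mu> i)"
        using \<mu>[of i] by (simp add: frac_def field_simps)
      moreover have "\<bar>\<mu> i * frac (Im (w $ i) / \<mu> i)\<bar> \<le> \<bar>\<mu> i\<bar> * 1"
        unfolding abs_mult by (intro mult_left_mono) (auto simp: less_imp_le[OF frac_lt_1])
      moreover have "\<bar>frac (Re (w $ i))\<bar> \<le> 1"
        using frac_lt_1[of "Re (w $ i)"] frac_ge_0[of "Re (w $ i)"] by linarith
      ultimately show "cmod ((?v + w) $ i) \<le> 1 + \<bar>\<mu> i\<bar>"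
        using cmod_le[of "(?v + w) $ i"] by linarith
    qed
  qed
  define B where "B i = (\<Sum>j\<in>UNIV. \<bar>P $ i $ j\<bar>)" for i
  have real: "\<exists>p :: 'm \<times> bool \<Rightarrow> int. \<forall>i. \<bar>(x + P *v (\<chi> j. of_int (p j))) $ i\<bar> \<le> B i" for x
  proof
    let ?y = "matrix_inv P *v x"
    let ?p = "\<lambda>j. - \<lfloor>?y $ j\<rfloor>"
    have "x = P *v ?y"
      using matrix_inv_P(1) by (simp add: matrix_vector_mul_assoc)
    then have "x + P *v (\<chi> j. of_int (?p j)) = P *v (?y + (\<chi> j. of_int (?p j)))"
      by (simp only: matrix_vector_right_distrib)
    also have "?y + (\<chi> j. of_int (?p j)) = (\<chi> j. frac (?y $ j))"
      by (simp add: Finite_Cartesian_Product.vec_eq_iff frac_def)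
    finally have eq: "(x + P *v (\<chi> j. of_int (?p j))) $ i = (\<Sum>j\<in>UNIV. P $ i $ j * frac (?y $ j))" for i
      by (simp add: matrix_vector_mult_def)
    have "\<bar>P $ i $ j * frac (?y $ j)\<bar> \<le> \<bar>P $ i $ j\<bar>" for i j
      unfolding abs_mult using frac_lt_1[of "?y $ j"] frac_ge_0[of "?y $ j"]
      by (intro mult_right_le_one_le) auto
    then show "\<forall>i. \<bar>(x + P *v (\<chi> j. of_int (?p j))) $ i\<bar> \<le> B i"
      unfolding eq B_def by (intro allI order.trans[OF sum_abs] sum_mono)
  qed
  have fibre: "\<exists>v\<in>lattice_fibre P. \<forall>i. cmod ((z + v) $ i) \<le> 2 * B i" for z
  proof -
    obtain p :: "'m \<times> bool \<Rightarrow> int" where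
      p: "\<And>i. \<bar>((\<chi> i. Re (z $ i)) + P *v (\<chi> j. of_int (p j))) $ i\<bar> \<le> B i"
      using real by blast
    obtain q :: "'m \<times> bool \<Rightarrow> int" where
      q: "\<And>i. \<bar>((\<chi> i. Im (z $ i)) + P *v (\<chi> j. of_int (q j))) $ i\<bar> \<le> B i"
      using real by blast
    let ?v = "\<chi> i. of_real ((P *v (\<chi> j. of_int (p j))) $ i) + \<i> * of_real ((P *v (\<chi> j. of_int (q j))) $ i)"
    have "?v \<in> lattice_fibre P"
      unfolding lattice_fibre_def by auto
    moreover have "cmod ((z + ?v) $ i) \<le> 2 * B i" for i
      using cmod_le[of "(z + ?v) $ i"] p[of i] q[of i] by simp
    ultimately show ?thesis by blast
  qed
  let ?R = "(\<Sum>i\<in>UNIV. 1 + \<bar>\<mu> i\<bar>) + (\<Sum>i\<in>UNIV. 2 * B i)"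
  have "\<exists>g\<in>\<Gamma>. norm (act g x) \<le> ?R" for x :: "('n, 'm) total_space"
  proof -
    obtain v where v: "v \<in> lattice_base lam k" "\<And>i. cmod ((v + fst x) $ i) \<le> 1 + \<bar>\<mu> i\<bar>"
      using base by blast
    \<comment> \<open>The base is reduced first, since moving it by \<open>v\<close> changes the
      fibre coordinate by \<open>rho lam v\<close>; the fibre lattice then leaves the base
      fixed.\<close>
    obtain u where u: "u \<in> lattice_fibre P" "\<And>i. cmod ((rho lam v *v snd x + u) $ i) \<le> 2 * B i"
      using fibre by blast
    have "norm (v + fst x) \<le> (\<Sum>i\<in>UNIV. 1 + \<bar>\<mu> i\<bar>)"
      using v(2) by (intro order.trans[OF norm_vec_le_sum] sum_mono)
    moreover have "norm (rho lam v *v snd x + u) \<le> (\<Sum>i\<in>UNIV. 2 * B i)"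
      using u(2) by (intro order.trans[OF norm_vec_le_sum] sum_mono)
    ultimately have "norm (v + fst x, rho lam v *v snd x + u) \<le> ?R"
      using norm_Pair_le[of "v + fst x" "rho lam v *v snd x + u"] by linarith
    then show ?thesis
      using v(1) u(1) by (intro bexI[of _ "(v, u)"]) (auto simp: semidirect_mult_def Defs.lattice_def case_prod_beta)
  qed
  then show ?thesis by blast
qed

end

section \<open>Bounded holomorphic functions are constant\<close>

text \<open>In the base directions this is Liouville's theorem.  Then the differential in the fibre
  directions commutes with the complex structures at all points of the base simultaneously,
  which forces it to vanish.\<close>

lemma bounded_J_holomorphic_constant:
  fixes F :: "('n::finite, 'm::finite) total_space \<Rightarrow> complex"
  assumes lam: "lam \<noteq> 0"
    and D: "\<And>x. (F has_derivative D x) (at x)"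
    and J: "\<And>x v. D x (J_frame lam x v) = \<i> * D x v"
    and bounded: "bounded (range F)"
  shows "F x = F y"
proof -
  have lin: "linear (D x)" for x
    using D has_derivative_linear by blast
  have base: "F (w + u, z) = F (w, z)" for w u z
  proof -
    \<comment> \<open>The complex line through \<open>(w, z)\<close> in direction \<open>u\<close>,
      on which F restricts to a bounded entire function of \<open>t\<close>.\<close>
    define \<gamma> where "\<gamma> t = (w + (\<chi> i. t * u $ i), z)" for t
    define h where "h t = F (\<gamma> t)" for t
    have "(h has_field_derivative D (\<gamma> t) (u, 0)) (at t)" for t
    proof -
      have "linear (\<lambda>s::complex. ((\<chi> i. s * u $ i), 0 :: complex ^ ('m \<times> bool)))"
        by (rule linearI; rule total_space_eqI)
          (simp_all add: algebra_simps scaleR_conv_of_real[where 'a = complex])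
      then have "((\<lambda>s. ((\<chi> i. s * u $ i), 0) + (w, z)) has_derivative (\<lambda>s. ((\<chi> i. s * u $ i), 0))) (at t)"
        by (intro has_derivative_add_const linear_imp_has_derivative)
      moreover have "\<gamma> = (\<lambda>s. ((\<chi> i. s * u $ i), 0) + (w, z))"
        by (simp add: \<gamma>_def fun_eq_iff add.commute)
      ultimately have "(\<gamma> has_derivative (\<lambda>s. ((\<chi> i. s * u $ i), 0))) (at t)"
        by simp
      from has_derivative_compose[OF this D]
      have "(h has_derivative (\<lambda>s. D (\<gamma> t) ((\<chi> i. s * u $ i), 0))) (at t)"
        by (simp add: h_def[abs_def])
      moreover have "D (\<gamma> t) ((\<chi> i. s * u $ i), 0) = D (\<gamma> t) (u, 0) * s" for s
      proof -
        have "((\<chi> i. s * u $ i), 0) = Re s *\<^sub>R (u, 0) + Im s *\<^sub>R J_frame lam (\<gamma> t) (u, 0)"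
          by (rule total_space_eqI)
            (simp_all add: J_frame_components scaleR_conv_of_real[where 'a = complex] complex_eq_iff)
        then have "D (\<gamma> t) ((\<chi> i. s * u $ i), 0) =
            of_real (Re s) * D (\<gamma> t) (u, 0) + of_real (Im s) * (\<i> * D (\<gamma> t) (u, 0))"
          by (simp only: linear_add[OF lin] linear_scale[OF lin] J scaleR_conv_of_real[where 'a = complex])
        then show ?thesis
          by (simp add: complex_eq_iff)
      qed
      ultimately show ?thesis
        by (simp add: has_field_derivative_def)
    qed
    then have "h holomorphic_on UNIV"
      by (auto simp: holomorphic_on_def field_differentiable_def intro: has_field_derivative_at_within)
    moreover have "bounded (range h)"
      by (rule bounded_subset[OF bounded]) (auto simp: h_def)
    ultimately have "h constant_on UNIV"
      by (rule Liouville_theorem)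
    then have "h 1 = h 0"
      by (auto simp: constant_on_def)
    moreover have "\<gamma> 1 = (w + u, z)" "\<gamma> 0 = (w, z)"
      by (auto simp: \<gamma>_def Finite_Cartesian_Product.vec_eq_iff)
    ultimately show ?thesis
      by (simp add: h_def)
  qed
  have D_base: "D x (u, 0) = 0" for x u
  proof -
    have "((\<lambda>s. F (x + s *\<^sub>R (u, 0))) has_derivative (\<lambda>s. D x (s *\<^sub>R (u, 0)))) (at (0::real))"
    proof (rule has_derivative_compose[where f = "\<lambda>s. x + s *\<^sub>R (u, 0)"])
      show "((\<lambda>s. x + s *\<^sub>R (u, 0)) has_derivative (\<lambda>s. s *\<^sub>R (u, 0))) (at 0)"
        by (auto intro!: derivative_eq_intros)
      show "(F has_derivative D x) (at (x + 0 *\<^sub>R (u, 0)))"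
        using D[of x] by (simp add: zero_prod_def[symmetric])
    qed
    moreover have "F (x + s *\<^sub>R (u, 0)) = F x" for s
      using base[of "fst x" "s *\<^sub>R u" "snd x"] by (cases x) simp
    ultimately have "((\<lambda>s::real. F x) has_derivative (\<lambda>s. D x (s *\<^sub>R (u, 0)))) (at 0)"
      by simp
    then have "(\<lambda>s::real. D x (s *\<^sub>R (u, 0))) = (\<lambda>_. 0)"
      using has_derivative_unique has_derivative_const by blast
    from fun_cong[OF this, of 1] show ?thesis by simp
  qed
  \<comment> \<open>F does not depend on w, so its differential at a point of the fibre direction is
    the same over every base point.\<close>
  have fibre: "D (w, z) (0, v) = D (0, z) (0, v)" for w z v
  proof -
    have "F (y + (w, 0)) = F y" for y
      using base[of "fst y" w "snd y"] by (cases y) simp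
    moreover have "((\<lambda>y. F (y + (w, 0))) has_derivative D (w, z)) (at (0, z))"
    proof (rule has_derivative_compose[where f = "\<lambda>y. y + (w, 0)" and f' = "\<lambda>y. y", simplified])
      show "((\<lambda>y. y + (w, 0)) has_derivative (\<lambda>y. y)) (at (0, z))"
        by (auto intro!: derivative_eq_intros)
      show "(F has_derivative D (w, z)) (at ((0, z) + (w, 0)))"
        using D[of "(w, z)"] by simp
    qed
    ultimately have "(F has_derivative D (w, z)) (at (0, z))"
      by simp
    then have "D (w, z) = D (0, z)"
      using has_derivative_unique D by blast
    then show ?thesis by simp
  qed
  have D_fibre: "D (w, z) (0, v) = 0" for w z v
  proof -
    let ?L = "\<lambda>v. D (0, z) (0, v)"
    define x0 :: "('n, 'm) total_space" where "x0 = (0, z)"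
    \<comment> \<open>A base point with \<open>a_form w1 = 1\<close>, where the scale of the fibre
      structure is e^(2 lam), different from its value 1 over the base point 0.\<close>
    define w1 :: "complex ^ ('n \<times> bool)" where "w1 = axis (undefined, False) 1"
    \<comment> \<open>The two halves of the fibre are treated separately because the structures at
      \<open>w1\<close> and 0 differ by the factor 1/r on one and by r on the other.\<close>
    define vF where "vF = (\<chi> l. if snd l then 0 else v $ l)"
    define vT where "vT = (\<chi> l. if snd l then v $ l else 0)"
    define r where "r = exp (2 * lam)"
    have r: "r \<noteq> 1" "r > 0"
      using lam by (auto simp: r_def)
    have "w1 $ (i, False) + cnj (w1 $ (i, True)) = (if i = undefined then 1 else 0)" for i
      by (simp add: w1_def axis_def)
    then have "a_form w1 = 1"
      by (simp add: a_form_def)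
    then have a1: "a_exp lam (w1, z) * cnj (a_exp lam (w1, z)) = of_real r"
      by (simp add: a_exp_def r_def exp_cnj exp_of_real exp_add[symmetric] flip: of_real_mult)
    have a0: "a_exp lam x0 = 1"
      by (simp add: a_exp_def x0_def)
    have J1: "?L (snd (J_frame lam (w1, z) (0, v'))) = \<i> * ?L v'"
      and J0: "?L (snd (J_frame lam x0 (0, v'))) = \<i> * ?L v'" for v'
    proof -
      have c: "(0, snd (J_frame lam x (0, v'))) = J_frame lam x (0, v')" for x :: "('n, 'm) total_space"
        by (rule prod_eqI) (simp_all add: Finite_Cartesian_Product.vec_eq_iff J_frame_components)
      show "?L (snd (J_frame lam (w1, z) (0, v'))) = \<i> * ?L v'"
      proof -
        have "D (w1, z) (0, snd (J_frame lam (w1, z) (0, v'))) = \<i> * D (w1, z) (0, v')"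
          by (simp only: c J)
        then show ?thesis
          by (simp only: fibre[of w1 z])
      qed
      have "D x0 (0, snd (J_frame lam x0 (0, v'))) = \<i> * D x0 (0, v')"
        by (simp only: c J)
      then show "?L (snd (J_frame lam x0 (0, v'))) = \<i> * ?L v'"
        by (simp only: x0_def)
    qed
    have scale: "?L (c *\<^sub>R v') = of_real c * ?L v'" for c v'
      using linear_scale[OF lin, of "(0, z)" c "(0, v')"] by (simp add: scaleR_conv_of_real[where 'a = complex])
    \<comment> \<open>Complex linearity for both structures gives i L(vF) = (1/r) i L(vF), hence
      L(vF) = 0 as r is not 1.\<close>
    have "((0, snd (J_frame lam (w1, z) (0, vF))) :: ('n, 'm) total_space) = (0, inverse r *\<^sub>R snd (J_frame lam x0 (0, vF)))"
      by (rule total_space_eqI)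
        (simp_all add: J_frame_components a1 a0 vF_def scaleR_conv_of_real[where 'a = complex] field_simps)
    then have "\<i> * ?L vF = of_real (inverse r) * (\<i> * ?L vF)"
      using J1[of vF] J0[of vF] scale by simp
    moreover have "of_real (inverse r) \<noteq> (1::complex)"
      using r by (simp add: of_real_eq_1_iff del: of_real_inverse)
    ultimately have F0: "?L vF = 0"
      by (metis complex_i_not_zero mult_cancel_right1 mult_eq_0_iff)
    have "((0, snd (J_frame lam (w1, z) (0, vT))) :: ('n, 'm) total_space) = (0, r *\<^sub>R snd (J_frame lam x0 (0, vT)))"
      by (rule total_space_eqI)
        (simp_all add: J_frame_components a1 a0 vT_def scaleR_conv_of_real[where 'a = complex] field_simps)
    then have "\<i> * ?L vT = of_real r * (\<i> * ?L vT)"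
      using J1[of vT] J0[of vT] scale by simp
    moreover have "of_real r \<noteq> (1::complex)"
      using r by simp
    ultimately have T0: "?L vT = 0"
      by (metis complex_i_not_zero mult_cancel_right1 mult_eq_0_iff)
    have "((0, v) :: ('n, 'm) total_space) = (0, vF) + (0, vT)"
      by (auto simp: vF_def vT_def Finite_Cartesian_Product.vec_eq_iff)
    then have "?L v = ?L vF + ?L vT"
      by (simp only: linear_add[OF lin])
    then show ?thesis
      using F0 T0 fibre[of w z v] by simp
  qed
  have "D x v = 0" for x v
  proof -
    have "D x v = D x (fst v, 0) + D x (0, snd v)"
      using linear_add[OF lin, of x "(fst v, 0)" "(0, snd v)"] by simp
    then show ?thesis
      using D_base D_fibre[of "fst x" "snd x"] by simp
  qed
  then have "D x = (\<lambda>_. 0)" for x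
    by blast
  then have "(F has_derivative (\<lambda>_. 0)) (at x)" for x
    using D[of x] by simp
  then show ?thesis
    using has_derivative_zero_unique[of UNIV F x y] by auto
qed


section \<open>Pluricanonical sections\<close>

text \<open>A tensor power of a line is a line, spanned by the power of \<Phi>.\<close>

lemma (in unimodular_frame) tensor_power_eq:
  assumes "T \<in> tensor_power r (canonical_fibre (J x))"
  shows "T v = T (\<lambda>_. E x) * (\<Prod>i<r. \<Phi> x (v i))"
proof -
  obtain N :: nat and \<omega> where \<omega>: "\<And>k i. k < N \<Longrightarrow> i < r \<Longrightarrow> \<omega> k i \<in> canonical_fibre (J x)"
    and T: "T = (\<lambda>v. \<Sum>k<N. pure_tensor r (\<omega> k) v)"
    using assms unfolding tensor_power_def by blast
  have "pure_tensor r (\<omega> k) v = pure_tensor r (\<omega> k) (\<lambda>_. E x) * (\<Prod>i<r. \<Phi> x (v i))" if "k < N" for k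
    unfolding pure_tensor_def prod.distrib[symmetric]
    by (intro prod.cong refl canonical_fibre_eq \<omega> that) simp
  then show ?thesis
    by (simp add: T sum_distrib_right)
qed

section \<open>The left-invariant coframe as a unimodular frame\<close>

definition enumeration :: "nat \<Rightarrow> 'k::finite" where
  "enumeration = (SOME e. bij_betw e {..<CARD('k)} UNIV)"

lemma bij_enumeration: "bij_betw enumeration {..<CARD('k)} (UNIV :: 'k::finite set)"
  unfolding enumeration_def
  using ex_bij_betw_nat_finite[of "UNIV :: 'k set"]
  by (intro someI_ex[of "\<lambda>e. bij_betw e {..<CARD('k)} UNIV"]) (simp add: atLeast0LessThan)

lemma enumeration_inject:
  "i < CARD('k) \<Longrightarrow> j < CARD('k) \<Longrightarrow> enumeration i = (enumeration j :: 'k::finite) \<longleftrightarrow> i = j"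
  using bij_betw_imp_inj_on[OF bij_enumeration[where 'k = 'k]] by (auto dest: inj_onD)

lemma enumeration_surj: "\<exists>i<CARD('k). enumeration i = (l :: 'k::finite)"
  using bij_betw_imp_surj_on[OF bij_enumeration[where 'k = 'k]] by (metis UNIV_I imageE lessThan_iff)

lemma sum_enumeration: "(\<Sum>i<CARD('k). f (enumeration i :: 'k::finite)) = (\<Sum>l\<in>UNIV. f l)"
  using sum.reindex_bij_betw[OF bij_enumeration] .

lemma cdim_total_space:
  "cdim TYPE(('n::finite, 'm::finite) total_space) = CARD(('n \<times> bool) + ('m \<times> bool))"
  by (simp add: cdim_def)

text \<open>The bijection \<open>enumeration\<close> is arbitrary; another choice changes \<Phi> at
  most by a sign. The coefficients t are nonzero only at the \<alpha>'s, whose differentials have no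
  torsion.\<close>

interpretation frame: unimodular_frame "cdim TYPE(('n::finite, 'm::finite) total_space)"
  "J_frame lam :: ('n, 'm) total_space \<Rightarrow> _" "\<lambda>x k. alpha_beta lam (enumeration k) x"
  "\<lambda>x k. dual_frame lam (enumeration k) x" "\<lambda>k. connection_form lam (enumeration k)"
  "torsion_factor lam" "\<lambda>x k. torsion_form lam (enumeration k) x"
  "\<lambda>k. case enumeration k :: ('n \<times> bool) + ('m \<times> bool) of Inl i \<Rightarrow> - of_real (lam / 2) | Inr j \<Rightarrow> 0"
  for lam
proof (rule unimodular_frame.intro)
  show "linear (torsion_form lam (enumeration k) x)" for k and x :: "('n, 'm) total_space"
  proof (cases "enumeration k :: ('n \<times> bool) + ('m \<times> bool)")
    case (Inl i)
    then show ?thesis by (auto intro!: linearI simp: torsion_form_def)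
  next
    case (Inr p)
    obtain j s where "p = (j, s)" by (cases p)
    with Inr have "torsion_form lam (enumeration k) x = cnj \<circ> alpha_beta lam (Inr (j, \<not> s)) x"
      by (simp add: torsion_form_def fun_eq_iff)
    then show ?thesis
      using linear_compose[OF linear_alpha_beta bounded_linear.linear[OF bounded_linear_cnj]] by metis
  qed
  show "torsion_form lam (enumeration k) x (J_frame lam x v) = - \<i> * torsion_form lam (enumeration k) x v"
    for k and x v :: "('n, 'm) total_space"
    by (auto simp: torsion_form_def alpha_beta_J_frame split: sum.split prod.split)
  show "v = 0" if "\<And>k. k < cdim TYPE(('n, 'm) total_space) \<Longrightarrow> alpha_beta lam (enumeration k) x v = 0"
    for x v :: "('n, 'm) total_space"
    using that unfolding cdim_total_space by (intro alpha_beta_inj[of lam x]) (metis enumeration_surj)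
  show "torsion_form lam (enumeration k) x v = 0"
    if "(case enumeration k :: ('n \<times> bool) + ('m \<times> bool) of Inl i \<Rightarrow> - complex_of_real (lam / 2) | Inr j \<Rightarrow> 0) \<noteq> 0"
    for k and x v :: "('n, 'm) total_space"
    using that by (auto simp: torsion_form_def split: sum.splits)
  show "(\<Sum>k<cdim TYPE(('n, 'm) total_space). connection_form lam (enumeration k) h) = 0"
    for h :: "('n, 'm) total_space"
    unfolding cdim_total_space sum_enumeration[where f = "\<lambda>l. connection_form lam l h"]
    by (rule sum_connection_form)
  show "clin (torsion_factor lam) (vec10 (J_frame lam x) v) = (\<Sum>k<cdim TYPE(('n, 'm) total_space).
      (case enumeration k :: ('n \<times> bool) + ('m \<times> bool) of Inl i \<Rightarrow> - of_real (lam / 2) | Inr j \<Rightarrow> 0) *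
      alpha_beta lam (enumeration k) x v)" for x v :: "('n, 'm) total_space"
    unfolding cdim_total_space sum_enumeration[where f =
      "\<lambda>l. (case l of Inl i \<Rightarrow> - of_real (lam / 2) | Inr j \<Rightarrow> 0) * alpha_beta lam l x v"]
    by (rule torsion_factor_10)
  show "alpha_beta lam (enumeration k) x (dual_frame lam (enumeration l) x) = (if k = l then 1 else 0)"
    if "k < cdim TYPE(('n, 'm) total_space)" "l < cdim TYPE(('n, 'm) total_space)"
    for k l and x :: "('n, 'm) total_space"
    using that enumeration_inject[of k l, where 'k = "('n \<times> bool) + ('m \<times> bool)"]
    unfolding cdim_total_space by (simp only: alpha_beta_dual_frame)
qed (simp_all add: linear_J_frame J_frame_J_frame linear_alpha_beta alpha_beta_J_frame smooth_alpha_beta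
    alpha_beta_derivative linear_torsion_factor)

lemma frame_\<Phi>_translation:
  "frame.\<Phi> lam (semidirect_mult lam g x) (\<lambda>i. translation_deriv lam g (v i)) = frame.\<Phi> lam x v"
  unfolding frame.\<Phi>_def by (intro det_form_cong) (simp add: alpha_beta_translation)

text \<open>The coframe determines the structure: each of its members turns \<open>J c x\<close>
  into multiplication by the imaginary unit, and together they separate vectors.\<close>

lemma coframe10_J_eq:
  assumes "coframe10 A J (\<lambda>c. alpha_beta lam)" "c \<in> A" "x \<in> fst c"
  shows "J c x = J_frame lam x"
proof
  fix v
  have "alpha_beta lam l x (J c x v) = \<i> * alpha_beta lam l x v" for l
  proof -
    let ?\<theta> = "alpha_beta lam l x"
    have one: "{..<1::nat} = {0}"
      by auto
    have "(\<lambda>v. ?\<theta> (v 0)) \<in> forms_of_type 1 0 (J c x)"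
      using assms unfolding coframe10_def by blast
    then have type: "type_component 1 0 (J c x) (\<lambda>v. ?\<theta> (v 0)) (\<lambda>_. v) = ?\<theta> v"
      by (simp add: forms_of_type_def)
    have "(\<lambda>v. ?\<theta> (v 0)) = (\<lambda>v. \<Prod>i<(1::nat). ?\<theta> (v i))"
      by (simp add: fun_eq_iff one)
    then have "type_component 1 0 (J c x) (\<lambda>v. ?\<theta> (v 0)) (\<lambda>_. v) = cext 1 (\<lambda>v. \<Prod>i<1. ?\<theta> (v i))
        (\<lambda>i. if i < 1 then vec10 (J c x) v else vec01 (J c x) v)"
      by (simp only: type_component_full)
    also have "\<dots> = clin ?\<theta> (vec10 (J c x) v)"
      by (subst cext_prod) (simp add: one)
    finally have "clin ?\<theta> (vec10 (J c x) v) = ?\<theta> v"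
      using type by simp
    then show ?thesis
      by (simp add: clin_def vec10_def linear_scale[OF linear_alpha_beta] linear_neg[OF linear_alpha_beta]
          scaleR_conv_of_real[where 'a = complex] complex_eq_iff)
  qed
  then have "alpha_beta lam l x (J c x v - J_frame lam x v) = 0" for l
    by (simp add: linear_diff[OF linear_alpha_beta] alpha_beta_J_frame)
  then show "J c x v = J_frame lam x v"
    using alpha_beta_inj by (metis eq_iff_diff_eq_0)
qed

section \<open>Holomorphic sections and plurigenera of the solvmanifold\<close>

locale invariant_structure = solvmanifold_data M P lam k
  for M :: "int ^ ('m::finite \<times> bool) ^ ('m \<times> bool)"
    and P :: "real ^ ('m \<times> bool) ^ ('m \<times> bool)" and lam :: real and k :: "'n::finite \<times> bool \<Rightarrow> int" +
  fixes J :: "(('n, 'm) total_space, ('n, 'm) total_space set) chart \<Rightarrow>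
              ('n, 'm) total_space \<Rightarrow> ('n, 'm) total_space \<Rightarrow> ('n, 'm) total_space"
  assumes coframe: "coframe10 (solvmanifold lam k P) J (\<lambda>c. alpha_beta lam)"
begin

abbreviation "\<A> \<equiv> solvmanifold lam k P"
abbreviation "vol \<equiv> frame.\<Phi> lam :: ('n, 'm) total_space \<Rightarrow> _"
abbreviation "dual x \<equiv> \<lambda>i. dual_frame lam (enumeration i) (x :: ('n, 'm) total_space)"

lemma chartE:
  assumes "c \<in> \<A>"
  obtains U where "c = (U, cs)" "open U"
  using assms by (auto simp: solvmanifold_def)

lemma J_eq: "c \<in> \<A> \<Longrightarrow> x \<in> fst c \<Longrightarrow> J c x = J_frame lam x"
  using coframe by (rule coframe10_J_eq)

definition volume_power :: "nat \<Rightarrow> (('n, 'm) total_space, ('n, 'm) total_space set) chart \<Rightarrow>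
    ('n, 'm) total_space \<Rightarrow> ('n, 'm) total_space tensor" where
  "volume_power r c x v = (if c \<in> \<A> \<and> x \<in> fst c then \<Prod>i<r. vol x (v i) else 0)"

text \<open>In every chart the coefficient with respect to the power of \<Phi> is the constant 1,
  whose differential vanishes. Left invariance of \<Phi> gives compatibility with the transition
  maps.\<close>

lemma volume_power_holomorphic:
  assumes r: "r > 0"
  shows "volume_power r \<in> holomorphic_pluricanonical_sections \<A> J r"
proof -
  have "volume_power r c x \<in> tensor_power r (canonical_fibre (J c x))" if "c \<in> \<A>" "x \<in> fst c" for c x
    unfolding tensor_power_def mem_Collect_eq
    using that frame.\<Phi>_in_canonical_fibre[of lam x]
    by (intro exI[of _ 1] exI[of _ "\<lambda>_ _. vol x"])
      (auto simp: volume_power_def[abs_def] pure_tensor_def J_eq)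
  moreover have "smooth_on (fst c) (\<lambda>x. volume_power r c x v)" if "c \<in> \<A>" for c v
  proof (rule smooth_on_cong)
    show "open (fst c)"
      using chartE[OF that] by (metis fst_conv)
    then show "smooth_on (fst c) (\<lambda>x. \<Prod>i<r. vol x (v i))"
      by (intro smooth_on_prod smooth_on_subset[OF frame.smooth_\<Phi>]) auto
    show "(\<Prod>i<r. vol x (v i)) = volume_power r c x v" if "x \<in> fst c" for x
      using \<open>c \<in> \<A>\<close> that by (simp add: volume_power_def)
  qed
  moreover have "volume_power r c x v = volume_power r c' (transition c c' x)
      (\<lambda>i j. frechet_derivative (transition c c') (at x) (v i j))"
    if c: "c \<in> \<A>" "c' \<in> \<A>" and x: "x \<in> overlap c c'" for c c' x v
  proof -
    obtain U U' where U: "c = (U, cs)" "c' = (U', cs)"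
      using chartE c by metis
    have "x \<in> U"
      using x U by (simp add: overlap_def)
    obtain g where g: "g \<in> \<Gamma>" "act g x \<in> U'"
      using overlapD x U by metis
    show ?thesis
      using solvmanifold_transition(2,3)[OF _ _ \<open>x \<in> U\<close> g] c \<open>x \<in> U\<close> g(2)
      unfolding U by (simp add: volume_power_def frame_\<Phi>_translation)
  qed
  moreover have "dbar_power r (J c) (volume_power r c) x = (\<lambda>u v. 0)" if "c \<in> \<A>" "x \<in> fst c" for c x
  proof -
    obtain U where U: "c = (U, cs)" "open U"
      using chartE[OF \<open>c \<in> \<A>\<close>] .
    have "dbar_power r (J c) (volume_power r c) x = (\<lambda>u v. dbar_fun (J_frame lam x)
        (frechet_derivative (\<lambda>_. 1) (at x)) u * (\<Prod>i<r. vol x (v i)))"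
      using U that by (intro frame.dbar_power_multiple[where W = U] r)
        (auto simp: J_eq smooth_on_const volume_power_def)
    then show ?thesis
      by (simp add: dbar_fun_def)
  qed
  ultimately show ?thesis
    unfolding holomorphic_pluricanonical_sections_def pluricanonical_sections_def
    by (auto simp: volume_power_def)
qed

text \<open>The charts cover the whole group, so the coefficients of \<open>s\<close> glue to one
  lattice-invariant function F there, which is bounded by cocompactness and satisfies the
  Cauchy-Riemann equation. Hence it is constant.\<close>

lemma holomorphic_section_multiple:
  assumes r: "r > 0" and s: "s \<in> holomorphic_pluricanonical_sections \<A> J r"
  obtains a where "s = scale_section a (volume_power r)"
proof -
  define chart_at where "chart_at x = (SOME c. c \<in> \<A> \<and> x \<in> fst c)" for x
  have chart_at: "chart_at x \<in> \<A> \<and> x \<in> fst (chart_at x)" for x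
    unfolding chart_at_def by (rule someI_ex) (use chart_around[of x] in \<open>metis fst_conv\<close>)
  define f where "f c x = s c x (\<lambda>_. dual x)" for c x
  define F where "F x = f (chart_at x) x" for x
  have s_eq: "s c x v = f c x * (\<Prod>i<r. vol x (v i))" if "c \<in> \<A>" "x \<in> fst c" for c x v
  proof -
    have "s c x \<in> tensor_power r (canonical_fibre (J c x))"
      using s that by (simp add: holomorphic_pluricanonical_sections_def pluricanonical_sections_def)
    then show ?thesis
      unfolding f_def J_eq[OF that] by (rule frame.tensor_power_eq)
  qed
  have invariant: "f c' (act g x) = f c x"
    if c: "c \<in> \<A>" "x \<in> fst c" "c' \<in> \<A>" "act g x \<in> fst c'" and g: "g \<in> \<Gamma>" for c c' g x
  proof -
    obtain U U' where U: "c = (U, cs)" "c' = (U', cs)"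
      using chartE c by metis
    have x: "x \<in> U" "act g x \<in> U'"
      using c U by auto
    have trans: "x \<in> overlap c c'" "transition c c' x = act g x"
      "frechet_derivative (transition c c') (at x) = translation_deriv lam g"
      unfolding U using solvmanifold_transition[OF _ _ x(1) g x(2)] c U by blast+
    have "\<forall>c\<in>\<A>. \<forall>c'\<in>\<A>. \<forall>x\<in>overlap c c'. \<forall>v. s c x v = s c' (transition c c' x)
        (\<lambda>i j. frechet_derivative (transition c c') (at x) (v i j))"
      using s unfolding holomorphic_pluricanonical_sections_def pluricanonical_sections_def by blast
    from this[rule_format, OF c(1,3) trans(1)]
    have "s c x v = s c' (act g x) (\<lambda>i j. translation_deriv lam g (v i j))" for v
      unfolding trans .
    from this[of "\<lambda>_. dual x"] show ?thesis
      using s_eq[OF c(1,2), of "\<lambda>_. dual x"] s_eq[OF c(3,4)]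
      by (simp add: frame_\<Phi>_translation frame.\<Phi>_E)
  qed
  \<comment> \<open>Invariance under the neutral element 0 of the lattice compares two charts that
    contain the same point.\<close>
  have F_eq: "f c x = F x" if "c \<in> \<A>" "x \<in> fst c" for c x
    using invariant[of "chart_at x" x c 0] that chart_at lattice_0
    by (simp add: F_def semidirect_mult_0)
  have F_invariant: "F (act g x) = F x" if "g \<in> \<Gamma>" for g x
    unfolding F_def using invariant[OF _ _ _ _ that] chart_at by blast
  define D where "D x = frechet_derivative F (at x)" for x
  have D: "(F has_derivative D x) (at x) \<and> (\<forall>u. D x (J_frame lam x u) = \<i> * D x u)" for x
  proof -
    obtain c where c: "c \<in> \<A>" "x \<in> fst c"
      using chart_at by blast
    obtain U where U: "c = (U, cs)" "open U"
      using chartE[OF c(1)] .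
    have x: "x \<in> U"
      using c U by simp
    \<comment> \<open>The frame is frozen at \<open>x\<close>, so that the section is evaluated on
      constant vectors, where its smoothness is known.\<close>
    have a: "F y * (\<Prod>i<r. vol y (dual x)) = s c y (\<lambda>_. dual x)" if "y \<in> U" for y
      using s_eq[of c y] F_eq[of c y] c U that by simp
    have b: "smooth_on U (\<lambda>y. s c y (\<lambda>_. dual x))"
      using s c U by (auto simp: holomorphic_pluricanonical_sections_def pluricanonical_sections_def)
    have v: "smooth_on U (\<lambda>y. \<Prod>i<r. vol y (dual x))"
      using U by (intro smooth_on_prod smooth_on_subset[OF frame.smooth_\<Phi>]) auto
    have "(\<Prod>i<r. vol x (dual x)) \<noteq> 0"
      by (simp add: frame.\<Phi>_E)
    then obtain W where W: "open W" "x \<in> W" "W \<subseteq> U" "smooth_on W F"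
      by (rule smooth_quotient_near[OF U(2) x b v _ a])
    have "dbar_power r (J c) (s c) x =
        (\<lambda>u v. dbar_fun (J_frame lam x) (D x) u * (\<Prod>i<r. vol x (v i)))"
      unfolding D_def
    proof (rule frame.dbar_power_multiple[OF r W(1,2) _ W(4)])
      show "J c y = J_frame lam y" if "y \<in> W" for y
        using c(1) U W(3) that by (intro J_eq) auto
      show "s c y = (\<lambda>v. F y * (\<Prod>i<r. vol y (v i)))" if "y \<in> W" for y
        using s_eq[OF c(1), of y] F_eq[OF c(1), of y] U W that by auto
    qed
    moreover have "dbar_power r (J c) (s c) x = (\<lambda>u v. 0)"
      using s c by (auto simp: holomorphic_pluricanonical_sections_def)
    ultimately have "dbar_fun (J_frame lam x) (D x) u * (\<Prod>i<r. vol x (v i)) = 0" for u v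
      by metis
    \<comment> \<open>On the dual frame the power of the volume form is 1 and drops out.\<close>
    from this[of _ "\<lambda>_. dual x"] have "D x u + \<i> * D x (J_frame lam x u) = 0" for u
      by (simp add: frame.\<Phi>_E dbar_fun_def)
    then have "\<i> * (D x u + \<i> * D x (J_frame lam x u)) = 0" for u
      by simp
    then have "D x (J_frame lam x u) = \<i> * D x u" for u
      by (simp add: distrib_left mult.assoc[symmetric])
    moreover have "(F has_derivative D x) (at x)"
      unfolding D_def using smooth_on_differentiable[OF W(4,1,2)] by (simp add: frechet_derivative_works)
    ultimately show ?thesis by blast
  qed
  have "bounded (range F)"
  proof -
    obtain R where R: "\<And>x :: ('n, 'm) total_space. \<exists>g\<in>\<Gamma>. norm (act g x) \<le> R"
      using cocompact by blast
    have "continuous_on (cball 0 R) F"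
      using D by (intro continuous_at_imp_continuous_on ballI has_derivative_continuous) blast
    then have "bounded (F ` cball 0 R)"
      by (intro compact_imp_bounded compact_continuous_image) auto
    moreover have "range F \<subseteq> F ` cball 0 R"
    proof
      fix y
      assume "y \<in> range F"
      then obtain x where "y = F x" by blast
      moreover obtain g where "g \<in> \<Gamma>" "norm (act g x) \<le> R"
        using R by blast
      ultimately show "y \<in> F ` cball 0 R"
        using F_invariant by (intro image_eqI[of _ _ "act g x"]) auto
    qed
    ultimately show ?thesis
      by (rule bounded_subset)
  qed
  then have const: "F x = F 0" for x
    using D by (intro bounded_J_holomorphic_constant[OF lam, of F D]) auto
  have "s c x v = F 0 * volume_power r c x v" for c x v
  proof (cases "c \<in> \<A> \<and> x \<in> fst c")
    case True
    then show ?thesis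
      using s_eq F_eq const[of x] by (simp add: volume_power_def)
  next
    case False
    then have "s c x = (\<lambda>v. 0)"
      using s unfolding holomorphic_pluricanonical_sections_def pluricanonical_sections_def by blast
    with False show ?thesis
      by (auto simp: volume_power_def)
  qed
  then have "s = scale_section (F 0) (volume_power r)"
    by (simp add: scale_section_def fun_eq_iff)
  then show thesis by (rule that)
qed

lemma plurigenus_1:
  assumes r: "r > 0"
  shows "plurigenus \<A> J r = 1"
proof -
  interpret V: vector_space "scale_section :: complex \<Rightarrow>
      ((('n, 'm) total_space, ('n, 'm) total_space set) chart \<Rightarrow>
      ('n, 'm) total_space \<Rightarrow> ('n, 'm) total_space tensor) \<Rightarrow> _"
    by unfold_locales (auto simp: scale_section_def fun_eq_iff algebra_simps)
  let ?H = "holomorphic_pluricanonical_sections \<A> J r" and ?\<sigma> = "volume_power r"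
  have H: "?H \<subseteq> V.span {?\<sigma>}"
    using holomorphic_section_multiple[OF r] unfolding V.span_singleton by blast
  \<comment> \<open>The section takes the value 1 on the dual frame over the neutral element, so it
    is a basis of its span.\<close>
  have "?\<sigma> \<noteq> 0"
  proof
    assume 0: "?\<sigma> = 0"
    obtain U where U: "(U, cs) \<in> \<A>" "0 \<in> U"
      using chart_around .
    have "?\<sigma> (U, cs) 0 (\<lambda>_. dual 0) = 1"
      using U by (simp add: volume_power_def frame.\<Phi>_E)
    then show False
      using 0 by simp
  qed
  then have "V.dim ?H = 1"
    using volume_power_holomorphic[OF r] H by (intro V.dim_unique[of "{?\<sigma>}"]) auto
  moreover have "\<exists>B. finite B \<and> ?H \<subseteq> V.span B"
    using H by (intro exI[of _ "{?\<sigma>}"]) auto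
  ultimately show ?thesis
    by (simp add: plurigenus_def one_enat_def)
qed

end

theorem proposition4p2:
  fixes M :: "int ^ ('m::finite \<times> bool) ^ ('m \<times> bool)"
    and P :: "real ^ ('m \<times> bool) ^ ('m \<times> bool)"
    and lam :: real
    and k :: "'n::finite \<times> bool \<Rightarrow> int"
    and J :: "(('n, 'm) total_space, ('n, 'm) total_space set) chart \<Rightarrow>
              ('n, 'm) total_space \<Rightarrow> ('n, 'm) total_space \<Rightarrow> ('n, 'm) total_space"
  assumes "det M = 1"
    and "invertible P"
    and "lam \<noteq> 0"
    and "P ** real_matrix M ** matrix_inv P =
           diag_matrix (\<lambda>(j, b). if b then exp (- lam) else exp lam)"
    and "\<And>i. k i \<noteq> 0"
    and "almost_complex_structure (solvmanifold lam k P) J"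
    and "coframe10 (solvmanifold lam k P) J (\<lambda>c. alpha_beta lam)"
  shows "kodaira_dimension (solvmanifold lam k P) J = 0"
proof -
  interpret invariant_structure M P lam k J
    using assms by unfold_locales auto
  \<comment> \<open>The numerator is log 1 = 0 for every positive \<open>r\<close>; this covers
    \<open>r = 1\<close> too, as 0 divided by 0 is 0 in \<open>ereal\<close>.\<close>
  have "\<forall>\<^sub>F r in sequentially. log_enat (plurigenus \<A> J r) / ereal (ln (real r)) = 0"
    using eventually_gt_at_top[of 0]
    by eventually_elim (simp add: plurigenus_1 log_enat_def one_enat_def divide_ereal_def zero_ereal_def[symmetric])
  then have "limsup (\<lambda>r. log_enat (plurigenus \<A> J r) / ereal (ln (real r))) = limsup (\<lambda>_. 0)"
    by (rule Limsup_eq)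
  moreover have "\<not> (\<forall>r\<ge>1. plurigenus \<A> J r = 0)"
    using plurigenus_1[of 1] by auto
  ultimately show ?thesis
    by (simp add: kodaira_dimension_def Limsup_const)
qed

end
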